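(* Let $R>0$ and let $u_0,u_1\in C_0^\infty(\mathbf{R}^2)$ be real-valued with $\operatorname{supp} u_j\subset\{x\in\mathbf{R}^2: |x|\le R\}$ for $j=0,1$. Let $a:\mathbf{R}^2\to\mathbf{R}$ satisfy: (A-1) $a\in C^2(\mathbf{R}^2)$, $a(x)\ge 0$ for all $x\in\mathbf{R}^2$, and $a$ is bounded on $\mathbf{R}^2$; (A-2) there exist constants $L>0$ and $\varepsilon_0>0$ such that $a(x)\ge\varepsilon_0$ for all $x\in\mathbf{R}^2$ with $|x|>L$. Let $u(t,x)$ be the unique smooth (classical) solution of the Cauchy problem $$u_{tt}-\Delta u+a(x)u_t=0\quad\text{in }(0,\infty)\times\mathbf{R}^2,\qquad u(0,x)=u_0(x),\quad u_t(0,x)=u_1(x)\quad (x\in\mathbf{R}^2).$$ Then $$\int_{\mathbf{R}^2}|u(t,x)|^2\,dx=O(t^{-1}\log t)\quad (t\to\infty),$$ $$E_u(t)=O(t^{-2}\log t)\quad(t\to\infty),$$ where $E_u(t)=\frac12\int_{\mathbf{R}^2}\left(|u_t(t,x)|^2+|\nabla u(t,x)|^2\right)dx$.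
   Context: All functions are real-valued. Under the stated assumptions it is known that the Cauchy problem has a unique smooth (classical) solution $u(t,x)$, and that it has the finite propagation property $u(t,x)=0$ for $|x|>R+t$, $t\ge 0$. *)

theory Defs
  imports "HOL-Analysis.Analysis" "HOL-Library.Landau_Symbols"
begin

text \<open>
  \<open>Ck_on k f S\<close>: \<open>f\<close> is of class \<open>C^k\<close> on \<open>S\<close>. Derivatives are taken within \<open>S\<close>, so that for
  the closed half space \<open>{0..} \<times> UNIV\<close> they are one-sided (but unique) on the boundary. Continuity
  of \<open>\<lambda>x. f' x v\<close> for every \<open>v\<close> amounts to continuity of \<open>f'\<close> because the domain is
  finite-dimensional.
\<close>

primrec Ck_on :: "nat \<Rightarrow> ('a::euclidean_space \<Rightarrow> real) \<Rightarrow> 'a set \<Rightarrow> bool" where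
  "Ck_on 0 f S \<longleftrightarrow> continuous_on S f"
| "Ck_on (Suc k) f S \<longleftrightarrow>
     (\<exists>f'. (\<forall>x\<in>S. (f has_derivative f' x) (at x within S)) \<and> (\<forall>v. Ck_on k (\<lambda>x. f' x v) S))"

definition supp :: "('a::euclidean_space \<Rightarrow> real) \<Rightarrow> 'a set" where
  "supp f = closure {x. f x \<noteq> 0}"

text \<open>The space \<open>C_0^\<infinity>\<close> of compactly supported smooth functions.\<close>

definition test_function :: "('a::euclidean_space \<Rightarrow> real) \<Rightarrow> bool" where
  "test_function f \<longleftrightarrow> (\<forall>k. Ck_on k f UNIV) \<and> compact (supp f)"

definition partial_deriv :: "'a::euclidean_space \<Rightarrow> ('a \<Rightarrow> real) \<Rightarrow> 'a \<Rightarrow> real" where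
  "partial_deriv b f x = deriv (\<lambda>h. f (x + h *\<^sub>R b)) 0"

definition grad :: "('a::euclidean_space \<Rightarrow> real) \<Rightarrow> 'a \<Rightarrow> 'a" where
  "grad f x = (\<Sum>b\<in>Basis. partial_deriv b f x *\<^sub>R b)"

definition laplacian :: "('a::euclidean_space \<Rightarrow> real) \<Rightarrow> 'a \<Rightarrow> real" where
  "laplacian f x = (\<Sum>b\<in>Basis. partial_deriv b (partial_deriv b f) x)"

text \<open>
  The derivative \<open>u_t\<close>. It is two-sided and hence only meaningful for \<open>t > 0\<close>: functions on
  \<open>[0,\<infinity>) \<times> R^2\<close> are represented by total functions whose values at negative times are arbitrary.
\<close>

definition dt :: "(real \<Rightarrow> 'a \<Rightarrow> real) \<Rightarrow> real \<Rightarrow> 'a \<Rightarrow> real" where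
  "dt u t x = deriv (\<lambda>s. u s x) t"

text \<open>
  Classical solutions are of class \<open>C^2\<close> up to the initial time; the initial velocity is the
  one-sided time derivative at \<open>t = 0\<close>.
\<close>

definition classical_solution ::
    "(real^2 \<Rightarrow> real) \<Rightarrow> (real^2 \<Rightarrow> real) \<Rightarrow> (real^2 \<Rightarrow> real) \<Rightarrow> (real \<Rightarrow> real^2 \<Rightarrow> real) \<Rightarrow> bool" where
  "classical_solution a u0 u1 u \<longleftrightarrow>
     Ck_on 2 (\<lambda>(t, x). u t x) ({0..} \<times> UNIV) \<and>
     (\<forall>t>0. \<forall>x. dt (dt u) t x - laplacian (u t) x + a x * dt u t x = 0) \<and>
     (\<forall>x. u 0 x = u0 x) \<and>
     (\<forall>x. ((\<lambda>t. u t x) has_real_derivative u1 x) (at 0 within {0..}))"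

definition energy_density :: "(real \<Rightarrow> real^2 \<Rightarrow> real) \<Rightarrow> real \<Rightarrow> real^2 \<Rightarrow> real" where
  "energy_density u t x = \<bar>dt u t x\<bar>\<^sup>2 + (norm (grad (u t) x))\<^sup>2"

definition energy :: "(real \<Rightarrow> real^2 \<Rightarrow> real) \<Rightarrow> real \<Rightarrow> real" where
  "energy u t = 1/2 * (LINT x|lborel. energy_density u t x)"

end

theory Submission
  imports Defs
begin

text \<open>
  Let \<open>E\<close> be the energy, \<open>A = \<integral> a u\<^sup>2\<close>. The multipliers \<open>u\<^sub>t\<close>, \<open>u\<close> and a bounded modification of
  \<open>x \<cdot> grad u\<close> combine to a functional \<open>G\<close> comparable to \<open>E + A\<close> with \<open>G' \<le> - c E\<close>: the field
  \<open>x\<close> controls the ball where the damping may vanish, the damping controls the rest. The time integral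
  \<open>v\<close> of \<open>u\<close> solves the same equation with a compactly supported right-hand side \<open>f\<close>; its energy
  identity says that \<open>\<Psi> = \<integral> (u\<^sup>2 + |grad v|\<^sup>2) / 2 - f v\<close> satisfies \<open>\<Psi>' = - A\<close>, and by finite propagation and a
  two-dimensional Hardy inequality with logarithmic loss \<open>\<Psi> \<ge> - C log t\<close>. Hence, for suitable constants,
  \<open>t G + C\<^sub>1 G + C\<^sub>2 \<Psi> + c t\<^sup>2 E / 2\<close> is nonincreasing, which gives \<open>t G + t\<^sup>2 E = O(log t)\<close>;
  finally \<open>\<integral> u\<^sup>2\<close> is bounded by a multiple of \<open>E + A\<close>.
\<close>

subsection \<open>Integrals of compactly supported functions\<close>

text \<open>The bounds on \<open>G\<close> alone give no rate: differentiating \<open>t G\<close>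
  leaves \<open>G\<close>, which contains \<open>A\<close>, while \<open>G'\<close> pays only for
  \<open>E\<close>. So \<open>A\<close> has to be integrable in time up to a logarithm, and that is
  what \<open>\<Psi>\<close> supplies. Its one term without a sign is \<open>f v\<close>, to be
  dominated by \<open>|grad v|^2\<close>; on the plane the Dirichlet integral does not control such
  a pairing uniformly in the size of the support, because the divergence of
  \<open>x / (1 + |x|^2)\<close> decays faster than its squared length. At time \<open>t\<close>
  everything lives in the ball of radius \<open>R + t\<close>, so a factor
  \<open>1 + ln (1 + |x|^2) / ln (1 + (R + t)^2)\<close> in the field restores enough divergence.
  Its price, one factor \<open>ln t\<close>, is the only source of the logarithm in the rates. The
  term \<open>c t^2 E / 2\<close> is free: its derivative is at most \<open>c t E\<close>, exactly
  what \<open>t G'\<close> offers. The field \<open>x\<close> itself would make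
  \<open>u_t (x . grad u)\<close> incomparable with the energy, hence the bounded modification; the
  price is a Jacobian with unequal eigenvalues, and the weight \<open>3/4\<close> of the multiplier
  \<open>u\<close> is chosen to leave room for both the kinetic and the gradient part.\<close>

lemma continuous_vanishing_integrable:
  fixes f :: "'a::euclidean_space \<Rightarrow> real"
  assumes cont: "continuous_on UNIV f" and vanish: "\<And>x. norm x > r \<Longrightarrow> f x = 0"
  shows "integrable lborel f"
proof -
  have "integrable lborel (\<lambda>x. indicator (cball 0 r) x *\<^sub>R f x)"
    by (rule borel_integrable_compact) (auto intro: continuous_on_subset[OF cont])
  moreover have "(\<lambda>x. indicator (cball 0 r) x *\<^sub>R f x) = f"
    using vanish by (auto simp: indicator_def fun_eq_iff not_le)
  ultimately show ?thesis by simp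
qed

text \<open>Bridge between Lebesgue integrals over the whole space and gauge integrals over a fixed
  box, on which differentiation under the integral and continuity in a parameter are carried
  out.\<close>

lemma lborel_integral_eq_box_integral:
  fixes f :: "'a::euclidean_space \<Rightarrow> real"
  assumes cont: "continuous_on UNIV f" and vanish: "\<And>x. x \<notin> cbox (-b) b \<Longrightarrow> f x = 0"
  shows "(LINT x|lborel. f x) = integral (cbox (-b) b) f"
proof -
  obtain r where r: "cbox (-b) b \<subseteq> ball 0 r"
    using bounded_subset_ballD[OF bounded_cbox, of "-b" b 0] by blast
  have "integrable lborel f"
    by (rule continuous_vanishing_integrable[OF cont, of r]) (use r vanish in force)
  then have "(LINT x|lborel. f x) = integral UNIV f"
    by (simp add: integral_lborel)
  also have "\<dots> = integral (cbox (-b) b) f"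
  proof (rule integral_spike_set)
    show "negligible {x \<in> UNIV - cbox (-b) b. f x \<noteq> 0}"
      by (rule negligible_subset[OF negligible_empty]) (use vanish in blast)
    show "negligible {x \<in> cbox (-b) b - UNIV. f x \<noteq> 0}" by simp
  qed
  finally show ?thesis .
qed

text \<open>One direction at a time suffices: every integration by parts below treats the two
  components of a flux separately.\<close>

definition dir_deriv :: "'a::real_normed_vector \<Rightarrow> ('a \<Rightarrow> real) \<Rightarrow> ('a \<Rightarrow> real) \<Rightarrow> bool" where
  "dir_deriv e f D \<longleftrightarrow> (\<forall>x. ((\<lambda>h. f (x + h *\<^sub>R e)) has_real_derivative D x) (at 0))"

lemma dir_deriv_line:
  assumes "dir_deriv e f D"
  shows "((\<lambda>h. f (x + h *\<^sub>R e)) has_real_derivative D (x + h0 *\<^sub>R e)) (at h0)"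
proof -
  have "((\<lambda>h. f ((x + h0 *\<^sub>R e) + h *\<^sub>R e)) has_real_derivative D (x + h0 *\<^sub>R e)) (at 0)"
    using assms by (auto simp: dir_deriv_def)
  then have "((\<lambda>h. f (x + (h0 + h) *\<^sub>R e)) has_real_derivative D (x + h0 *\<^sub>R e)) (at 0)"
    by (simp add: scaleR_add_left add.assoc)
  then show ?thesis
    using DERIV_shift[of "\<lambda>h. f (x + h *\<^sub>R e)" _ 0 h0] by (simp add: add.commute)
qed

lemma dir_deriv_vanishing:
  assumes d: "dir_deriv e f D" and v: "\<And>x. norm x > r \<Longrightarrow> f x = 0" and x: "norm x > r"
  shows "D x = 0"
proof -
  have "((\<lambda>h. f (x + h *\<^sub>R e)) has_real_derivative D x) (at 0)"
    using d by (auto simp: dir_deriv_def)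
  moreover have "((\<lambda>h. norm (x + h *\<^sub>R e)) \<longlongrightarrow> norm (x + 0 *\<^sub>R e)) (at 0)"
    by (intro tendsto_intros)
  then have "eventually (\<lambda>h. norm (x + h *\<^sub>R e) > r) (at 0)"
    using x by (intro order_tendstoD(1)) auto
  then have "eventually (\<lambda>h. norm (x + h *\<^sub>R e) > r) (nhds 0)"
    using x by (simp add: eventually_nhds_conv_at)
  then have "eventually (\<lambda>h. f (x + h *\<^sub>R e) = 0) (nhds 0)"
    by eventually_elim (rule v)
  then have "((\<lambda>h. f (x + h *\<^sub>R e)) has_real_derivative 0) (at 0)"
    by (subst DERIV_cong_ev[OF refl _ refl]) auto
  ultimately show ?thesis by (rule DERIV_unique)
qed

text \<open>By translation invariance the integral of \<open>f (x + h *\<^sub>R e)\<close> is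
  constant in \<open>h\<close>; differentiating under the integral at \<open>h = 0\<close> gives the
  integral of \<open>D\<close>.\<close>

lemma integral_dir_deriv_eq_0:
  fixes f :: "'a::euclidean_space \<Rightarrow> real"
  assumes d: "dir_deriv e f D" and cf: "continuous_on UNIV f" and cD: "continuous_on UNIV D"
    and v: "\<And>x. norm x > r \<Longrightarrow> f x = 0"
  shows "(LINT x|lborel. D x) = 0"
proof -
  \<comment> \<open>The extra \<open>norm e\<close> keeps all translates with
    \<open>\<bar>h\<bar> < 1\<close> supported in one box.\<close>
  obtain b where b: "cball 0 (r + norm e) \<subseteq> cbox (-b) (b::'a)"
    using bounded_subset_cbox_symmetric[OF bounded_cball] by blast
  let ?K = "cbox (-b) b"
  have vD: "norm x > r \<Longrightarrow> D x = 0" for x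
    by (rule dir_deriv_vanishing[OF d v])
  have out: "norm x > r + norm e" if "x \<notin> ?K" for x
    using that b by force
  have const: "integral ?K (\<lambda>x. f (x + h *\<^sub>R e)) = (LINT x|lborel. f x)" if "h \<in> {-1<..<1}" for h
  proof -
    have "(LINT x|lborel. f (x + h *\<^sub>R e)) = integral ?K (\<lambda>x. f (x + h *\<^sub>R e))"
    proof (rule lborel_integral_eq_box_integral)
      show "continuous_on UNIV (\<lambda>x. f (x + h *\<^sub>R e))"
        by (intro continuous_on_compose2[OF cf] continuous_intros) auto
      fix x assume "x \<notin> ?K"
      then have "norm x > r + norm e" by (rule out)
      moreover have "norm x \<le> norm (x + h *\<^sub>R e) + norm (h *\<^sub>R e)"
        using norm_triangle_ineq4[of "x + h *\<^sub>R e" "h *\<^sub>R e"] by simp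
      moreover have "norm (h *\<^sub>R e) \<le> norm e"
        using that mult_right_mono[of "\<bar>h\<bar>" 1 "norm e"] by auto
      ultimately show "f (x + h *\<^sub>R e) = 0" by (intro v) linarith
    qed
    moreover have "(LINT x|lborel. f (x + h *\<^sub>R e)) = (LINT x|lborel. f x)"
      by (subst lborel_distr_plus[of "h *\<^sub>R e", symmetric], subst integral_distr)
        (use cf in \<open>auto intro!: borel_measurable_continuous_onI simp: add.commute\<close>)
    ultimately show ?thesis by simp
  qed
  have "((\<lambda>h. integral ?K (\<lambda>x. f (x + h *\<^sub>R e))) has_real_derivative integral ?K (\<lambda>x. D (x + 0 *\<^sub>R e)))
      (at 0 within {-1<..<1})"
    by (rule leibniz_rule_field_derivative)
      (auto intro!: has_field_derivative_at_within[OF dir_deriv_line[OF d]] integrable_continuous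
        continuous_on_compose2[OF cf] continuous_on_compose2[OF cD] continuous_intros simp: split_beta)
  then have "((\<lambda>h. integral ?K (\<lambda>x. f (x + h *\<^sub>R e))) has_real_derivative integral ?K D) (at 0)"
    by (subst (asm) at_within_open) auto
  moreover have "((\<lambda>h. integral ?K (\<lambda>x. f (x + h *\<^sub>R e))) has_real_derivative 0) (at 0)"
  proof -
    have "eventually (\<lambda>h. integral ?K (\<lambda>x. f (x + h *\<^sub>R e)) = (LINT x|lborel. f x)) (nhds (0::real))"
      using eventually_nhds_in_open[of "{-1<..<1}" "0::real"] const by (auto elim!: eventually_mono)
    then show ?thesis by (subst DERIV_cong_ev[OF refl _ refl]) auto
  qed
  ultimately have "integral ?K D = 0" by (rule DERIV_unique)
  moreover have "(LINT x|lborel. D x) = integral ?K D"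
  proof (rule lborel_integral_eq_box_integral[OF cD])
    show "D x = 0" if "x \<notin> ?K" for x
      using vD[of x] out[OF that] norm_ge_zero[of e] by linarith
  qed
  ultimately show ?thesis by simp
qed

text \<open>Common form of the energy identities: density \<open>P\<close>, flux
  \<open>(F1, F2)\<close>, source \<open>S\<close>. A support radius valid for all times in
  \<open>T\<close> permits differentiation under the integral over one box; the divergence
  \<open>D1 + D2\<close>, taken at the single time \<open>t\<close>, integrates to zero.\<close>

lemma balance_law:
  fixes P P' :: "real \<Rightarrow> 'a::euclidean_space \<Rightarrow> real"
  assumes T: "open T" "convex T" "t \<in> T"
    and P: "\<And>s x. s \<in> T \<Longrightarrow> ((\<lambda>s. P s x) has_real_derivative P' s x) (at s)"
    and contP: "\<And>s. s \<in> T \<Longrightarrow> continuous_on UNIV (P s)"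
    and contP': "continuous_on (T \<times> UNIV) (\<lambda>z. P' (fst z) (snd z))"
    and suppP: "\<And>s x. s \<in> T \<Longrightarrow> norm x > r \<Longrightarrow> P s x = 0"
    and F1: "dir_deriv e1 F1 D1" "continuous_on UNIV F1" "continuous_on UNIV D1"
      "\<And>x. norm x > r \<Longrightarrow> F1 x = 0"
    and F2: "dir_deriv e2 F2 D2" "continuous_on UNIV F2" "continuous_on UNIV D2"
      "\<And>x. norm x > r \<Longrightarrow> F2 x = 0"
    and eq: "\<And>x. P' t x = D1 x + D2 x + S x"
  shows "((\<lambda>s. LINT x|lborel. P s x) has_real_derivative (LINT x|lborel. S x)) (at t)"
proof -
  obtain b where b: "cball 0 r \<subseteq> cbox (-b) (b::'a)"
    using bounded_subset_cbox_symmetric[OF bounded_cball] by blast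
  let ?K = "cbox (-b) b"
  have out: "norm x > r" if "x \<notin> ?K" for x
    using that b by force
  have contP't: "continuous_on UNIV (P' t)"
    by (rule continuous_on_compose2[OF contP', of UNIV "Pair t", simplified])
      (use T in \<open>auto intro!: continuous_intros\<close>)
  have vP': "P' t x = 0" if "norm x > r" for x
  proof -
    have "((\<lambda>s. P s x) has_real_derivative 0) (at t)"
      using suppP[OF _ that] eventually_nhds_in_open[OF T(1,3)]
      by (subst DERIV_cong_ev[OF refl _ refl, of _ "\<lambda>_. 0"]) (auto elim!: eventually_mono)
    with P[OF T(3)] show ?thesis by (rule DERIV_unique)
  qed
  have "((\<lambda>s. integral ?K (P s)) has_real_derivative integral ?K (P' t)) (at t within T)"
  proof (rule leibniz_rule_field_derivative)
    show "continuous_on (T \<times> ?K) (\<lambda>(s, x). P' s x)"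
      using continuous_on_subset[OF contP', of "T \<times> ?K"] by (auto simp: split_beta)
    show "P s integrable_on ?K" if "s \<in> T" for s
      by (rule integrable_continuous, rule continuous_on_subset[OF contP[OF that]]) simp
    show "((\<lambda>s. P s x) has_real_derivative P' s x) (at s within T)" if "s \<in> T" for s x
      by (rule has_field_derivative_at_within[OF P[OF that]])
  qed (use T in auto)
  then have "((\<lambda>s. integral ?K (P s)) has_real_derivative integral ?K (P' t)) (at t)"
    using T by (subst (asm) at_within_open) auto
  moreover have "integral ?K (P s) = (LINT x|lborel. P s x)" if "s \<in> T" for s
    by (rule lborel_integral_eq_box_integral[symmetric]) (use that contP suppP out in auto)
  then have "eventually (\<lambda>s. integral ?K (P s) = (LINT x|lborel. P s x)) (nhds t)"
    using eventually_nhds_in_open[OF T(1,3)] by (auto elim!: eventually_mono)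
  ultimately have "((\<lambda>s. LINT x|lborel. P s x) has_real_derivative integral ?K (P' t)) (at t)"
    by (subst (asm) DERIV_cong_ev[OF refl _ refl]) auto
  also have "integral ?K (P' t) = (LINT x|lborel. P' t x)"
    by (rule lborel_integral_eq_box_integral[symmetric]) (use contP't vP' out in auto)
  also have "\<dots> = (LINT x|lborel. D1 x + (D2 x + S x))"
    by (simp add: eq add.assoc)
  also have "\<dots> = (LINT x|lborel. D1 x) + ((LINT x|lborel. D2 x) + (LINT x|lborel. S x))"
  proof -
    have v1: "norm x > r \<Longrightarrow> D1 x = 0" for x by (rule dir_deriv_vanishing[OF F1(1,4)])
    have v2: "norm x > r \<Longrightarrow> D2 x = 0" for x by (rule dir_deriv_vanishing[OF F2(1,4)])
    have "S = (\<lambda>x. P' t x - D1 x - D2 x)" using eq by (auto simp: fun_eq_iff)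
    then have "integrable lborel S"
      using F1(3) F2(3) contP't v1 v2 vP' 
      by (auto intro!: continuous_vanishing_integrable[of _ r] continuous_intros)
    moreover have "integrable lborel D1" "integrable lborel D2"
      using F1(3) F2(3) v1 v2 by (auto intro!: continuous_vanishing_integrable[of _ r])
    ultimately show ?thesis by simp
  qed
  also have "\<dots> = (LINT x|lborel. S x)"
    by (simp add: integral_dir_deriv_eq_0[OF F1] integral_dir_deriv_eq_0[OF F2])
  finally show ?thesis .
qed

subsection \<open>Symmetry of second derivatives\<close>

text \<open>Apply the mean value theorem first to \<open>f s h - f s 0\<close> in \<open>s\<close>,
  then to \<open>f1 s r\<close> in \<open>r\<close>.\<close>

lemma second_difference_mvt:
  fixes f f1 f12 :: "real \<Rightarrow> real \<Rightarrow> real"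
  assumes f1: "\<And>s r. \<bar>s\<bar> \<le> h \<Longrightarrow> \<bar>r\<bar> \<le> h \<Longrightarrow> ((\<lambda>s. f s r) has_real_derivative f1 s r) (at s)"
    and f12: "\<And>s r. \<bar>s\<bar> \<le> h \<Longrightarrow> \<bar>r\<bar> \<le> h \<Longrightarrow> ((\<lambda>r. f1 s r) has_real_derivative f12 s r) (at r)"
    and h: "h > 0"
  obtains s r where "0 < s" "s < h" "0 < r" "r < h"
    "f h h - f h 0 - f 0 h + f 0 0 = h * h * f12 s r"
proof -
  have "\<exists>s. 0 < s \<and> s < h \<and>
      (f h h - f h 0) - (f 0 h - f 0 0) = (h - 0) * (f1 s h - f1 s 0)"
    using h by (intro MVT2[of 0 h "\<lambda>s. f s h - f s 0" "\<lambda>s. f1 s h - f1 s 0"])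
      (auto intro!: DERIV_diff f1)
  then obtain s where s: "0 < s" "s < h"
      "(f h h - f h 0) - (f 0 h - f 0 0) = h * (f1 s h - f1 s 0)" by auto
  have "\<exists>r. 0 < r \<and> r < h \<and> f1 s h - f1 s 0 = (h - 0) * f12 s r"
    using h s by (intro MVT2) (auto intro!: f12)
  then obtain r where "0 < r" "r < h" "f1 s h - f1 s 0 = h * f12 s r" by auto
  with s show ?thesis by (intro that[of s r]) (auto simp: algebra_simps)
qed

text \<open>The second difference over a small square is symmetric in the two variables, so
  \<open>h * h\<close> times a value of \<open>f12\<close> equals \<open>h * h\<close> times a value
  of \<open>f21\<close> at points near the origin. Continuity there excludes different
  limits.\<close>

lemma mixed_derivatives_eq:
  fixes f f1 f2 f12 f21 :: "real \<Rightarrow> real \<Rightarrow> real"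
  assumes d: "d > 0"
    and f1: "\<And>s r. \<bar>s\<bar> < d \<Longrightarrow> \<bar>r\<bar> < d \<Longrightarrow> ((\<lambda>s. f s r) has_real_derivative f1 s r) (at s)"
    and f2: "\<And>s r. \<bar>s\<bar> < d \<Longrightarrow> \<bar>r\<bar> < d \<Longrightarrow> ((\<lambda>r. f s r) has_real_derivative f2 s r) (at r)"
    and f12: "\<And>s r. \<bar>s\<bar> < d \<Longrightarrow> \<bar>r\<bar> < d \<Longrightarrow> ((\<lambda>r. f1 s r) has_real_derivative f12 s r) (at r)"
    and f21: "\<And>s r. \<bar>s\<bar> < d \<Longrightarrow> \<bar>r\<bar> < d \<Longrightarrow> ((\<lambda>s. f2 s r) has_real_derivative f21 s r) (at s)"
    and c: "isCont (\<lambda>z. f12 (fst z) (snd z)) (0, 0)" "isCont (\<lambda>z. f21 (fst z) (snd z)) (0, 0)"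
  shows "f12 0 0 = f21 0 0"
proof (rule ccontr)
  assume ne: "f12 0 0 \<noteq> f21 0 0"
  define e where "e = \<bar>f12 0 0 - f21 0 0\<bar> / 2"
  have e: "e > 0" using ne by (simp add: e_def)
  obtain d1 where d1: "d1 > 0" "\<And>z. dist z (0, 0) < d1 \<Longrightarrow> dist (f12 (fst z) (snd z)) (f12 0 0) < e"
    using c(1) e unfolding continuous_at_eps_delta by fastforce
  obtain d2 where d2: "d2 > 0" "\<And>z. dist z (0, 0) < d2 \<Longrightarrow> dist (f21 (fst z) (snd z)) (f21 0 0) < e"
    using c(2) e unfolding continuous_at_eps_delta by fastforce
  define h where "h = min d (min d1 d2) / 2"
  have h: "h > 0" "h < d" "2 * h \<le> d1" "2 * h \<le> d2" using d d1 d2 by (auto simp: h_def)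
  have near: "dist (s, r) (0, 0) < 2 * h" if "0 < s" "s < h" "0 < r" "r < h" for s r :: real
    using that sqrt_sum_squares_le_sum_abs[of s r] by (auto simp: dist_prod_def)
  obtain s r where sr: "0 < s" "s < h" "0 < r" "r < h"
    "f h h - f h 0 - f 0 h + f 0 0 = h * h * f12 s r"
    by (rule second_difference_mvt[of h f f1 f12]) (use h in \<open>auto intro!: f1 f12\<close>)
  obtain r' s' where sr': "0 < r'" "r' < h" "0 < s'" "s' < h"
    "f h h - f 0 h - f h 0 + f 0 0 = h * h * f21 s' r'"
    by (rule second_difference_mvt[of h "\<lambda>r s. f s r" "\<lambda>r s. f2 s r" "\<lambda>r s. f21 s r"])
      (use h in \<open>auto intro!: f2 f21\<close>)
  have "f12 s r = f21 s' r'"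
    using sr(5) sr'(5) h(1) by (simp add: algebra_simps)
  moreover have "dist (f12 s r) (f12 0 0) < e" "dist (f21 s' r') (f21 0 0) < e"
    using d1(2)[of "(s, r)"] d2(2)[of "(s', r')"] near[OF sr(1-4)] near[OF sr'(3,4,1,2)] h by auto
  ultimately show False using ne unfolding dist_real_def e_def by (smt (verit) field_sum_of_halves)
qed

text \<open>Reduction to two real variables by restricting \<open>f\<close> to the plane through
  \<open>z\<close> spanned by \<open>v\<close> and \<open>w\<close>.\<close>

lemma mixed_second_derivatives_eq:
  fixes f :: "'a::real_normed_vector \<Rightarrow> real"
  assumes O: "open Om" "z \<in> Om"
    and f: "\<And>y. y \<in> Om \<Longrightarrow> (f has_derivative f' y) (at y)"
    and v: "\<And>y. y \<in> Om \<Longrightarrow> ((\<lambda>y. f' y v) has_derivative fv y) (at y)"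
    and w: "\<And>y. y \<in> Om \<Longrightarrow> ((\<lambda>y. f' y w) has_derivative fw y) (at y)"
    and cv: "continuous_on Om (\<lambda>y. fv y w)" and cw: "continuous_on Om (\<lambda>y. fw y v)"
  shows "fv z w = fw z v"
proof -
  define g where "g = (\<lambda>s r. z + s *\<^sub>R v + r *\<^sub>R w)"
  have contg: "isCont (\<lambda>p. g (fst p) (snd p)) p" for p
    unfolding g_def by (intro continuous_intros)
  have "open ((\<lambda>p. g (fst p) (snd p)) -` Om)"
    by (rule open_vimage[OF O(1)]) (use contg in \<open>auto simp: continuous_on_eq_continuous_at\<close>)
  moreover have "(0, 0) \<in> ((\<lambda>p. g (fst p) (snd p)) -` Om)" using O by (simp add: g_def)
  ultimately obtain e where e: "e > 0" "ball (0, 0) e \<subseteq> ((\<lambda>p. g (fst p) (snd p)) -` Om)"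
    by (meson open_contains_ball)
  define d where "d = e / 2"
  have d: "d > 0" using e by (simp add: d_def)
  have inO: "g s r \<in> Om" if "\<bar>s\<bar> < d" "\<bar>r\<bar> < d" for s r
  proof -
    have "(s, r) \<in> ball (0, 0) e"
      using that sqrt_sum_squares_le_sum_abs[of s r] by (auto simp: dist_prod_def d_def)
    then show ?thesis using e(2) by auto
  qed
  have gs: "((\<lambda>s. g s r) has_derivative (\<lambda>h. h *\<^sub>R v)) (at s)" for s r
    unfolding g_def by (auto intro!: derivative_eq_intros)
  have gr: "((\<lambda>r. g s r) has_derivative (\<lambda>h. h *\<^sub>R w)) (at r)" for s r
    unfolding g_def by (auto intro!: derivative_eq_intros)
  have chain: "((\<lambda>s. F (G s)) has_real_derivative F' (G s) x) (at s)"
    if "(F has_derivative F' (G s)) (at (G s))" "(G has_derivative (\<lambda>h. h *\<^sub>R x)) (at s)"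
    for F :: "'a \<Rightarrow> real" and F' G s x
    using has_derivative_compose[OF that(2,1)] linear_cmul[OF has_derivative_linear[OF that(1)]]
    by (simp add: has_field_derivative_def mult_commute_abs)
  have "fv (g 0 0) w = fw (g 0 0) v"
  proof (rule mixed_derivatives_eq[OF d, where f = "\<lambda>s r. f (g s r)" and ?f1.0 = "\<lambda>s r. f' (g s r) v"
        and ?f2.0 = "\<lambda>s r. f' (g s r) w" and ?f12.0 = "\<lambda>s r. fv (g s r) w"
        and ?f21.0 = "\<lambda>s r. fw (g s r) v"])
    have in0: "g (fst (0, 0)) (snd (0, 0)) \<in> Om" using inO[of 0 0] d by simp
    show "isCont (\<lambda>p. fv (g (fst p) (snd p)) w) (0, 0)"
      by (rule isCont_o2[OF contg, where g = "\<lambda>y. fv y w"])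
        (use cv O(1) in0 in \<open>simp add: continuous_on_eq_continuous_at\<close>)
    show "isCont (\<lambda>p. fw (g (fst p) (snd p)) v) (0, 0)"
      by (rule isCont_o2[OF contg, where g = "\<lambda>y. fw y v"])
        (use cw O(1) in0 in \<open>simp add: continuous_on_eq_continuous_at\<close>)
  qed (auto intro!: f v w inO gs gr chain)
  then show ?thesis by (simp add: g_def)
qed

text \<open>The set \<open>I\<close> admits one-sided derivatives, which is how the time derivative
  at the boundary \<open>t = 0\<close> is reached.\<close>

lemma has_derivative_along_line:
  fixes f :: "'a::real_normed_vector \<Rightarrow> real"
  assumes "(f has_derivative f') (at z within S)" and "\<And>h. h \<in> I \<Longrightarrow> z + h *\<^sub>R v \<in> S"
  shows "((\<lambda>h. f (z + h *\<^sub>R v)) has_real_derivative f' v) (at 0 within I)"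
proof -
  have "((\<lambda>h. z + h *\<^sub>R v) has_derivative (\<lambda>h. h *\<^sub>R v)) (at 0 within I)"
    by (auto intro!: derivative_eq_intros)
  moreover have "(f has_derivative f') (at (z + 0 *\<^sub>R v) within (\<lambda>h. z + h *\<^sub>R v) ` I)"
    using assms by (auto intro: has_derivative_subset)
  ultimately have "((\<lambda>h. f (z + h *\<^sub>R v)) has_derivative (\<lambda>h. f' (h *\<^sub>R v))) (at 0 within I)"
    by (rule has_derivative_in_compose)
  then show ?thesis
    using linear_cmul[OF has_derivative_linear[OF assms(1)]]
    by (simp add: has_field_derivative_def mult_commute_abs)
qed

subsection \<open>Classical solutions in coordinates\<close>

abbreviation e1 :: "real^2" where "e1 \<equiv> axis 1 1"
abbreviation e2 :: "real^2" where "e2 \<equiv> axis 2 1"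

lemma sum_Basis_2: "(\<Sum>b\<in>Basis. f (b::real^2)) = f e1 + f e2"
proof -
  have "(Basis::(real^2) set) = {e1, e2}"
    by (auto simp: Basis_vec_def UNIV_2)
  then have "(\<Sum>b\<in>Basis. f (b::real^2)) = (\<Sum>b\<in>{e1, e2}. f b)"
    by (rule arg_cong)
  moreover have "e1 \<noteq> e2" by (simp add: axis_eq_axis)
  ultimately show ?thesis by simp
qed

text \<open>Continuity includes \<open>t = 0\<close>, while the derivative relations that follow are
  restricted to \<open>t > 0\<close>, where time derivatives are two-sided.\<close>

definition cont_st :: "(real \<Rightarrow> real^2 \<Rightarrow> real) \<Rightarrow> bool" where
  "cont_st f \<longleftrightarrow> continuous_on ({0..} \<times> UNIV) (\<lambda>z. f (fst z) (snd z))"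

definition dir_deriv_pos :: "real^2 \<Rightarrow> (real \<Rightarrow> real^2 \<Rightarrow> real) \<Rightarrow> (real \<Rightarrow> real^2 \<Rightarrow> real) \<Rightarrow> bool" where
  "dir_deriv_pos e f f' \<longleftrightarrow> (\<forall>t>0. dir_deriv e (f t) (f' t))"

definition time_deriv_pos :: "(real \<Rightarrow> real^2 \<Rightarrow> real) \<Rightarrow> (real \<Rightarrow> real^2 \<Rightarrow> real) \<Rightarrow> bool" where
  "time_deriv_pos f f' \<longleftrightarrow> (\<forall>t>0. \<forall>x. ((\<lambda>s. f s x) has_real_derivative f' t x) (at t))"

text \<open>The derivatives up to second order are explicit functions, so product rules and
  integrands stay algebraic. Each mixed derivative has one name that serves both orders of
  differentiation; symmetry is thus part of the assumptions. The equation is solved for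
  \<open>utt\<close>, ready to eliminate it.\<close>

locale damped_wave =
  fixes a :: "real^2 \<Rightarrow> real" and R :: real
    and u ut utt ux uy utx uty uxx uxy uyy :: "real \<Rightarrow> real^2 \<Rightarrow> real"
  assumes cont: "cont_st u" "cont_st ut" "cont_st utt" "cont_st ux" "cont_st uy"
      "cont_st utx" "cont_st uty" "cont_st uxx" "cont_st uxy" "cont_st uyy"
    and dt_pos: "time_deriv_pos u ut" "time_deriv_pos ut utt" "time_deriv_pos ux utx" "time_deriv_pos uy uty"
    and dx_pos: "dir_deriv_pos e1 u ux" "dir_deriv_pos e1 ut utx" "dir_deriv_pos e1 ux uxx" "dir_deriv_pos e1 uy uxy"
    and dy_pos: "dir_deriv_pos e2 u uy" "dir_deriv_pos e2 ut uty" "dir_deriv_pos e2 ux uxy" "dir_deriv_pos e2 uy uyy"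
    and wave_eq: "\<And>t x. t > 0 \<Longrightarrow> utt t x = uxx t x + uyy t x - a x * ut t x"
    and initial: "\<And>x. norm x > R \<Longrightarrow> u 0 x = 0 \<and> ut 0 x = 0 \<and> ux 0 x = 0 \<and> uy 0 x = 0"
    and R_pos: "R > 0"
    and cont_a: "continuous_on UNIV a" and a_nonneg: "\<And>x. a x \<ge> 0"

lemma classical_solution_damped_wave:
  assumes sol: "classical_solution a u0 u1 u" and R: "R > 0"
    and s0: "supp u0 \<subseteq> cball 0 R" and s1: "supp u1 \<subseteq> cball 0 R"
    and a: "Ck_on 2 a UNIV" "\<forall>x. a x \<ge> 0"
  obtains ut utt ux uy utx uty uxx uxy uyy where
    "damped_wave a R u ut utt ux uy utx uty uxx uxy uyy"
    "\<And>t x. t > 0 \<Longrightarrow> dt u t x = ut t x"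
    "\<And>t x. t > 0 \<Longrightarrow> (norm (grad (u t) x))\<^sup>2 = (ux t x)\<^sup>2 + (uy t x)\<^sup>2"
proof -
  define S :: "(real \<times> (real^2)) set" where "S = {0..} \<times> UNIV"
  define U where "U = (\<lambda>(t, x). u t x)"
  have "Ck_on (Suc (Suc 0)) U S"
    using sol by (simp add: classical_solution_def U_def S_def numeral_2_eq_2)
  then obtain U' where U': "\<And>z. z \<in> S \<Longrightarrow> (U has_derivative U' z) (at z within S)"
    and ex: "\<forall>v. \<exists>U''. (\<forall>z\<in>S. ((\<lambda>z. U' z v) has_derivative U'' z) (at z within S)) \<and>
        (\<forall>w. continuous_on S (\<lambda>z. U'' z w))"
    by auto
  from choice[OF ex] obtain U'' where U'': "\<And>v z. z \<in> S \<Longrightarrow> ((\<lambda>z. U' z v) has_derivative U'' v z) (at z within S)"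
    and cU'': "\<And>v w. continuous_on S (\<lambda>z. U'' v z w)"
    by blast
  have cU: "continuous_on S U" "\<And>v. continuous_on S (\<lambda>z. U' z v)"
    by (rule has_derivative_continuous_on[OF U'], assumption) (rule has_derivative_continuous_on[OF U''])
  define Om :: "(real \<times> (real^2)) set" where "Om = {0<..} \<times> UNIV"
  have Om: "open Om" "Om \<subseteq> S" by (auto simp: Om_def S_def intro: open_Times)
  \<comment> \<open>Away from the boundary the derivatives within the closed half space are ordinary
    ones.\<close>
  have at: "at z within S = at z" if "z \<in> Om" for z
    by (rule at_within_interior) (use that Om in \<open>auto simp: interior_def\<close>)
  have U'_at: "(U has_derivative U' z) (at z)" if "z \<in> Om" for z
    using U'[of z] that Om(2) unfolding at[OF that] by blast
  have U''_at: "((\<lambda>z. U' z v) has_derivative U'' v z) (at z)" if "z \<in> Om" for z v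
    using U''[of z v] that Om(2) unfolding at[OF that] by blast
  have sym: "U'' v z w = U'' w z v" if "z \<in> Om" for v w z
    by (rule mixed_second_derivatives_eq[where f' = U' and fv = "U'' v" and fw = "U'' w", OF Om(1) that])
      (assumption | rule U'_at U''_at continuous_on_subset[OF cU'' Om(2)])+
  define et ex ey :: "real \<times> (real^2)" where "et = (1, 0)" and "ex = (0, e1)" and "ey = (0, e2)"
  have Ut: "((\<lambda>s. u s x) has_real_derivative U' (t, x) et) (at t)" if "t > 0" for t x
  proof -
    have "((\<lambda>h. U ((t, x) + h *\<^sub>R et)) has_real_derivative U' (t, x) et) (at 0)"
      by (rule has_derivative_along_line[OF U'_at]) (use that in \<open>auto simp: Om_def\<close>)
    then show ?thesis
      using DERIV_shift[of "\<lambda>s. u s x" _ 0 t] by (simp add: et_def U_def add.commute)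
  qed
  have U't: "((\<lambda>s. U' (s, x) v) has_real_derivative U'' v (t, x) et) (at t)" if "t > 0" for t x v
  proof -
    have "((\<lambda>h. U' ((t, x) + h *\<^sub>R et) v) has_real_derivative U'' v (t, x) et) (at 0)"
      by (rule has_derivative_along_line[OF U''_at]) (use that in \<open>auto simp: Om_def\<close>)
    then show ?thesis
      using DERIV_shift[of "\<lambda>s. U' (s, x) v" _ 0 t] by (simp add: et_def add.commute)
  qed
  have Ue: "((\<lambda>h. u t (x + h *\<^sub>R e)) has_real_derivative U' (t, x) (0, e)) (at 0)" if "t \<ge> 0" for t x e
    using has_derivative_along_line[OF U'[of "(t, x)"], of UNIV "(0, e)"] that
    by (auto simp: S_def U_def)
  have U'e: "((\<lambda>h. U' (t, x + h *\<^sub>R e) v) has_real_derivative U'' v (t, x) (0, e)) (at 0)"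
    if "t \<ge> 0" for t x e v
    using has_derivative_along_line[OF U''[of "(t, x)"], of UNIV "(0, e)"] that
    by (auto simp: S_def U_def)
  have dt1: "dt u t x = U' (t, x) et" if "t > 0" for t x
    unfolding dt_def by (rule DERIV_imp_deriv[OF Ut[OF that]])
  have dt2: "dt (dt u) t x = U'' et (t, x) et" if "t > 0" for t x
  proof -
    have "eventually (\<lambda>s. s > 0) (nhds t)" using that by (auto intro: eventually_nhds_in_open[of "{0<..}", simplified])
    then have "eventually (\<lambda>s. dt u s x = U' (s, x) et) (nhds t)"
      by eventually_elim (rule dt1)
    then have "((\<lambda>s. dt u s x) has_real_derivative U'' et (t, x) et) (at t)"
      using U't[OF that, of x et] by (subst DERIV_cong_ev[OF refl _ refl])
    then show ?thesis unfolding dt_def[of "dt u"] by (rule DERIV_imp_deriv)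
  qed
  have pd1: "partial_deriv e (u t) = (\<lambda>x. U' (t, x) (0, e))" if "t > 0" for t e
    unfolding partial_deriv_def using that by (auto intro!: DERIV_imp_deriv Ue)
  have pd2: "partial_deriv e (partial_deriv e (u t)) x = U'' (0, e) (t, x) (0, e)" if "t > 0" for t e x
    unfolding pd1[OF that] unfolding partial_deriv_def using that by (auto intro!: DERIV_imp_deriv U'e)
  have zero0: "u0 x = 0" "u1 x = 0" if "norm x > R" for x
  proof -
    have "x \<notin> supp u0" "x \<notin> supp u1" using s0 s1 that by auto
    then show "u0 x = 0" "u1 x = 0"
      using closure_subset[of "{x. u0 x \<noteq> 0}"] closure_subset[of "{x. u1 x \<noteq> 0}"]
      unfolding supp_def by blast+
  qed
  have init: "u 0 x = u0 x" "((\<lambda>t. u t x) has_real_derivative u1 x) (at 0 within {0..})" for x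
    using sol by (auto simp: classical_solution_def)
  have U'0e: "U' (0, x) (0, e) = 0" if "norm x > R" for x e
  proof -
    have "dir_deriv e (u 0) (\<lambda>x. U' (0, x) (0, e))"
      unfolding dir_deriv_def by (auto intro: Ue)
    then show ?thesis
      by (rule dir_deriv_vanishing) (use that in \<open>auto simp: init(1) zero0\<close>)
  qed
  have U'0t: "U' (0, x) et = 0" if "norm x > R" for x
  proof -
    have "((\<lambda>h. U ((0, x) + h *\<^sub>R et)) has_real_derivative U' (0, x) et) (at 0 within {0..})"
      by (rule has_derivative_along_line[OF U']) (auto simp: S_def et_def)
    then have "((\<lambda>h. u h x) has_real_derivative U' (0, x) et) (at 0 within {0..})"
      by (simp add: et_def U_def)
    \<comment> \<open>Since \<open>0\<close> is a limit point of the half line, the one-sided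
      derivative is unique and \<open>U' (0, x) et\<close> must be the prescribed velocity.\<close>
    moreover have "at 0 within {0::real..} \<noteq> bot"
      by (simp add: at_within_Ici_at_right)
    ultimately have "U' (0, x) et = u1 x"
      using has_field_derivative_unique init(2)[of x] by blast
    then show ?thesis using zero0 that by simp
  qed
  have ca: "continuous_on UNIV a"
  proof -
    have "Ck_on (Suc (Suc 0)) a UNIV" using a by (simp add: numeral_2_eq_2)
    then show ?thesis by (auto intro: has_derivative_continuous_on)
  qed
  let ?D = "\<lambda>v t x. U' (t, x) v" and ?DD = "\<lambda>v w t x. U'' v (t, x) w"
  show ?thesis
  proof (rule that[of "?D et" "?DD et et" "?D ex" "?D ey" "?DD ex et" "?DD ey et" "?DD ex ex" "?DD ex ey" "?DD ey ey"])
    show "damped_wave a R u (?D et) (?DD et et) (?D ex) (?D ey) (?DD ex et) (?DD ey et) (?DD ex ex) (?DD ex ey) (?DD ey ey)"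
    proof
      show "cont_st u" using cU(1) by (simp add: cont_st_def S_def U_def split_beta)
      show "cont_st (?D et)" "cont_st (?D ex)" "cont_st (?D ey)"
        using cU(2) by (simp_all add: cont_st_def S_def)
      show "cont_st (?DD et et)" "cont_st (?DD ex et)" "cont_st (?DD ey et)" "cont_st (?DD ex ex)"
          "cont_st (?DD ex ey)" "cont_st (?DD ey ey)"
        using cU'' by (simp_all add: cont_st_def S_def)
      show "time_deriv_pos u (?D et)" "time_deriv_pos (?D et) (?DD et et)"
          "time_deriv_pos (?D ex) (?DD ex et)" "time_deriv_pos (?D ey) (?DD ey et)"
        by (auto simp: time_deriv_pos_def intro: Ut U't)
      \<comment> \<open>\<open>utx\<close> is chosen as the time derivative of \<open>ux\<close>;
        symmetry makes it also the space derivative of \<open>ut\<close>, and likewise for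
        \<open>uty\<close> and \<open>uxy\<close>.\<close>
      have sym': "U'' v (t, x) w = U'' w (t, x) v" if "t > 0" for v w t x
        by (rule sym) (use that in \<open>simp add: Om_def\<close>)
      show "dir_deriv_pos e1 u (?D ex)" "dir_deriv_pos e2 u (?D ey)"
        by (auto simp: dir_deriv_pos_def dir_deriv_def ex_def ey_def intro: Ue)
      show "dir_deriv_pos e1 (?D ex) (?DD ex ex)" "dir_deriv_pos e2 (?D ex) (?DD ex ey)"
          "dir_deriv_pos e2 (?D ey) (?DD ey ey)"
        by (auto simp: dir_deriv_pos_def dir_deriv_def ex_def ey_def intro: U'e)
      show "dir_deriv_pos e1 (?D et) (?DD ex et)" "dir_deriv_pos e2 (?D et) (?DD ey et)"
          "dir_deriv_pos e1 (?D ey) (?DD ex ey)"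
        by (auto simp: dir_deriv_pos_def dir_deriv_def sym'[where v=ex and w=et] sym'[where v=ey and w=et] sym'[where v=ex and w=ey])
          (auto simp: ex_def ey_def intro: U'e)
      show "?DD et et t x = ?DD ex ex t x + ?DD ey ey t x - a x * ?D et t x" if "t > 0" for t x
      proof -
        have "dt (dt u) t x - laplacian (u t) x + a x * dt u t x = 0"
          using sol that unfolding classical_solution_def by blast
        then show ?thesis
          using that by (simp add: dt1 dt2 laplacian_def pd2 sum_Basis_2 ex_def ey_def algebra_simps)
      qed
      show "u 0 x = 0 \<and> ?D et 0 x = 0 \<and> ?D ex 0 x = 0 \<and> ?D ey 0 x = 0" if "norm x > R" for x
        using that by (auto simp: U'0e U'0t init(1) zero0 ex_def ey_def)
    qed (use R ca a in auto)
    show "dt u t x = ?D et t x" if "t > 0" for t x using that by (rule dt1)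
    show "(norm (grad (u t) x))\<^sup>2 = (?D ex t x)\<^sup>2 + (?D ey t x)\<^sup>2" if "t > 0" for t x
      unfolding grad_def pd1[OF that] sum_Basis_2
      by (simp add: norm_vec_def L2_set_def UNIV_2 axis_def ex_def ey_def)
  qed
qed


lemma cont_stD:
  "cont_st f \<Longrightarrow> continuous_on S g \<Longrightarrow> continuous_on S h \<Longrightarrow> (\<And>z. z \<in> S \<Longrightarrow> g z \<ge> 0) \<Longrightarrow>
    continuous_on S (\<lambda>z. f (g z) (h z))"
  unfolding cont_st_def
  by (rule continuous_on_compose2[where f = "\<lambda>z. (g z, h z)", of "{0..} \<times> UNIV" "\<lambda>z. f (fst z) (snd z)", simplified])
    (auto intro!: continuous_intros)

text \<open>The square makes the positive part differentiable also at its zero, so a cut-off by a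
  light cone can enter a differentiated energy.\<close>

lemma DERIV_square_max_0:
  fixes f :: "real \<Rightarrow> real"
  assumes "(f has_real_derivative f') (at t)"
  shows "((\<lambda>t. (max 0 (f t))\<^sup>2) has_real_derivative 2 * max 0 (f t) * f') (at t)"
proof -
  have "((\<lambda>s. (max 0 s)\<^sup>2) has_real_derivative 2 * max 0 s) (at s)" for s :: real
  proof (cases s "0::real" rule: linorder_cases)
    case less
    have "((\<lambda>s. 0) has_real_derivative 2 * max 0 s) (at s)" using less by simp
    then show ?thesis
      by (rule has_field_derivative_transform_within_open[where S = "{..<0}"]) (use less in auto)
  next
    case greater
    have "((\<lambda>s. s\<^sup>2) has_real_derivative 2 * max 0 s) (at s)"
      using greater by (auto intro!: derivative_eq_intros)
    then show ?thesis
      by (rule has_field_derivative_transform_within_open[where S = "{0<..}"]) (use greater in auto)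
  next
    case equal
    have "((\<lambda>h::real. ((max 0 (0 + h))\<^sup>2 - (max 0 0)\<^sup>2) / h) \<longlongrightarrow> 0) (at 0)"
    proof (rule Lim_null_comparison)
      show "\<forall>\<^sub>F h in at (0::real). norm (((max 0 (0 + h))\<^sup>2 - (max 0 0)\<^sup>2) / h) \<le> \<bar>h\<bar>"
        by (rule always_eventually) (auto simp: max_def power2_eq_square)
    qed (auto intro!: tendsto_eq_intros)
    then show ?thesis using equal by (simp add: DERIV_def)
  qed
  from DERIV_chain2[OF this assms] show ?thesis by simp
qed

context damped_wave begin

lemmas cont_intros [continuous_intros] = cont[THEN cont_stD] continuous_on_compose2[OF cont_a _ subset_UNIV]

lemma DERIV_t:
  assumes "t > 0"
  shows "((\<lambda>s. u s x) has_real_derivative ut t x) (at t)"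
    "((\<lambda>s. ut s x) has_real_derivative utt t x) (at t)"
    "((\<lambda>s. ux s x) has_real_derivative utx t x) (at t)"
    "((\<lambda>s. uy s x) has_real_derivative uty t x) (at t)"
  using dt_pos assms by (auto simp: time_deriv_pos_def)

lemma DERIV_x:
  assumes "t > 0"
  shows "((\<lambda>h. u t (x + h *\<^sub>R e1)) has_real_derivative ux t x) (at 0)"
    "((\<lambda>h. ut t (x + h *\<^sub>R e1)) has_real_derivative utx t x) (at 0)"
    "((\<lambda>h. ux t (x + h *\<^sub>R e1)) has_real_derivative uxx t x) (at 0)"
    "((\<lambda>h. uy t (x + h *\<^sub>R e1)) has_real_derivative uxy t x) (at 0)"
  using dx_pos assms by (auto simp: dir_deriv_pos_def dir_deriv_def)

lemma DERIV_y:
  assumes "t > 0"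
  shows "((\<lambda>h. u t (x + h *\<^sub>R e2)) has_real_derivative uy t x) (at 0)"
    "((\<lambda>h. ut t (x + h *\<^sub>R e2)) has_real_derivative uty t x) (at 0)"
    "((\<lambda>h. ux t (x + h *\<^sub>R e2)) has_real_derivative uxy t x) (at 0)"
    "((\<lambda>h. uy t (x + h *\<^sub>R e2)) has_real_derivative uyy t x) (at 0)"
  using dy_pos assms by (auto simp: dir_deriv_pos_def dir_deriv_def)

end

subsection \<open>Finite propagation speed\<close>

lemma continuous_integral_le_0_imp_0:
  fixes f :: "'a::euclidean_space \<Rightarrow> real"
  assumes cont: "continuous_on UNIV f" and nonneg: "\<And>x. f x \<ge> 0"
    and vanish: "\<And>x. norm x > r \<Longrightarrow> f x = 0" and le: "(LINT x|lborel. f x) \<le> 0"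
  shows "f x = 0"
proof -
  \<comment> \<open>The box contains the support, the point \<open>x\<close> and a unit ball; the
    last makes its interior nonempty.\<close>
  obtain b where b: "cball 0 (max r (norm x) + 1) \<subseteq> cbox (-b) (b::'a)"
    using bounded_subset_cbox_symmetric[OF bounded_cball] by blast
  have int: "integrable lborel f" by (rule continuous_vanishing_integrable[OF cont vanish])
  have "(LINT x|lborel. f x) = integral (cbox (-b) b) f"
  proof (rule lborel_integral_eq_box_integral[OF cont])
    show "f y = 0" if "y \<notin> cbox (-b) b" for y
      using that b by (intro vanish) force
  qed
  moreover have "(LINT x|lborel. f x) \<ge> 0" using nonneg by simp
  ultimately have "integral (cbox (-b) b) f = 0" using le by simp
  moreover have "f integrable_on cbox (-b) b"
    by (rule integrable_continuous, rule continuous_on_subset[OF cont]) simp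
  ultimately have int0: "(f has_integral 0) (cbox (-b) b)" by (simp add: has_integral_iff)
  have "ball 0 1 \<subseteq> cball 0 (max r (norm x) + 1)" 
    by (rule order_trans[OF ball_subset_cball subset_cball]) (simp add: le_max_iff_disj)
  then have "ball 0 1 \<subseteq> cbox (-b) b" using b by blast
  then have "ball 0 1 \<subseteq> box (-b) b"
    using interior_maximal[OF _ open_ball] by (metis interior_cbox)
  then have ne: "box (-b) b \<noteq> {}" by force
  have "x \<in> cball 0 (max r (norm x) + 1)" by auto
  then have "x \<in> cbox (-b) b" using b by blast
  then show ?thesis
    using has_integral_0_cbox_imp_0[OF continuous_on_subset[OF cont] nonneg int0 ne] by simp
qed

lemma coord_line [simp]:
  "(x + h *\<^sub>R e1) $ 1 = x $ 1 + h" "(x + h *\<^sub>R e1) $ 2 = x $ 2"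
  "(x + h *\<^sub>R e2) $ 1 = x $ 1" "(x + h *\<^sub>R e2) $ 2 = x $ 2 + h"
  by (simp_all add: axis_def)

lemma norm_eq_coords: "(norm (x::real^2))\<^sup>2 = (x $ 1)\<^sup>2 + (x $ 2)\<^sup>2"
  by (simp add: norm_vec_def L2_set_def UNIV_2)

text \<open>The energy flux in a direction of length at most \<open>1\<close> never exceeds the
  energy density: Cauchy-Schwarz, then Young. This is propagation speed at most one in infinitesimal
  form.\<close>

lemma flux_le_energy:
  fixes r1 r2 p q v :: real
  assumes "r1\<^sup>2 + r2\<^sup>2 \<le> 1"
  shows "v * (r1 * p + r2 * q) \<le> (v\<^sup>2 + p\<^sup>2 + q\<^sup>2) / 2"
proof -
  have "(r1 * p + r2 * q)\<^sup>2 \<le> (r1\<^sup>2 + r2\<^sup>2) * (p\<^sup>2 + q\<^sup>2)"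
    using zero_le_power2[of "r1 * q - r2 * p"] by (simp add: algebra_simps power2_eq_square)
  also have "\<dots> \<le> 1 * (p\<^sup>2 + q\<^sup>2)" by (rule mult_right_mono[OF assms]) simp
  finally show ?thesis
    using zero_le_power2[of "v - (r1 * p + r2 * q)"] by (simp add: algebra_simps power2_eq_square)
qed

context damped_wave begin

text \<open>The energy is weighted by a power of the distance to the mantle of the backward light cone;
  smoothing \<open>norm (x - x0)\<close> to \<open>rho\<close> keeps its gradient bounded by \<open>1\<close>.\<close>

lemma backward_cone_vanishing:
  assumes x0: "T0 \<le> norm x0 - R" and t: "0 < t" and d: "d > 0" and td: "t + d < T0"
  shows "ut t x0 = 0" "ux t x0 = 0" "uy t x0 = 0"
proof -
  define rho where "rho = (\<lambda>x::real^2. sqrt (d\<^sup>2 + (x $ 1 - x0 $ 1)\<^sup>2 + (x $ 2 - x0 $ 2)\<^sup>2))"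
  define m where "m = (\<lambda>t x. T0 - t - rho x)"
  define P where "P = (\<lambda>t x. (max 0 (m t x))\<^sup>2 * ((ut t x)\<^sup>2 + (ux t x)\<^sup>2 + (uy t x)\<^sup>2) / 2)"
  define P' where "P' = (\<lambda>t x. - max 0 (m t x) * ((ut t x)\<^sup>2 + (ux t x)\<^sup>2 + (uy t x)\<^sup>2)
      + (max 0 (m t x))\<^sup>2 * (ut t x * utt t x + ux t x * utx t x + uy t x * uty t x))"
  \<comment> \<open>What is left of \<open>P'\<close> after the flux divergence: the loss because
    the weight decreases in time, the damping, and the flux paired with the gradient of the
    weight.\<close>
  define S where "S = (\<lambda>t x. - max 0 (m t x) * ((ut t x)\<^sup>2 + (ux t x)\<^sup>2 + (uy t x)\<^sup>2)
      - (max 0 (m t x))\<^sup>2 * (a x * (ut t x)\<^sup>2)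
      + 2 * max 0 (m t x) * (ut t x * ((x $ 1 - x0 $ 1) / rho x * ux t x + (x $ 2 - x0 $ 2) / rho x * uy t x)))"
  have rad: "d\<^sup>2 + (x $ 1 - x0 $ 1)\<^sup>2 + (x $ 2 - x0 $ 2)\<^sup>2 > 0" for x :: "real^2"
    using d by (simp add: add_pos_nonneg)
  have rho_pos: "rho x > 0" for x using rad by (simp add: rho_def)
  have rho_ge: "norm (x - x0) \<le> rho x" for x
  proof (rule power2_le_imp_le)
    show "(norm (x - x0))\<^sup>2 \<le> (rho x)\<^sup>2"
      using rad[of x] by (simp add: norm_eq_coords rho_def)
  qed (use rho_pos[of x] in simp)
  have m_neg: "m t x \<le> 0" if "t \<ge> 0" "norm x > norm x0 + T0" for t x
    using norm_triangle_ineq2[of x x0] rho_ge[of x] that by (auto simp: m_def)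
  have crho: "continuous_on A rho" for A unfolding rho_def by (intro continuous_intros)
  have cm: "continuous_on A g \<Longrightarrow> continuous_on A h \<Longrightarrow> continuous_on A (\<lambda>z. m (g z) (h z))"
    for A :: "'z::topological_space set" and g h
    unfolding m_def by (intro continuous_intros continuous_on_compose2[OF crho[of UNIV]]) auto
  have rho_x: "((\<lambda>h. rho (x + h *\<^sub>R e1)) has_real_derivative (x $ 1 - x0 $ 1) / rho x) (at 0)" for x
    unfolding rho_def coord_line using rad[of x]
    by (auto intro!: derivative_eq_intros simp: field_simps)
  have rho_y: "((\<lambda>h. rho (x + h *\<^sub>R e2)) has_real_derivative (x $ 2 - x0 $ 2) / rho x) (at 0)" for x
    unfolding rho_def coord_line using rad[of x]
    by (auto intro!: derivative_eq_intros simp: field_simps)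
  have m_t: "((\<lambda>s. (max 0 (m s x))\<^sup>2) has_real_derivative 2 * max 0 (m s x) * (-1)) (at s)" for s x
    unfolding m_def by (rule DERIV_square_max_0) (auto intro!: derivative_eq_intros)
  have m_x: "((\<lambda>h. (max 0 (m t (x + h *\<^sub>R e1)))\<^sup>2) has_real_derivative
      2 * max 0 (m t (x + 0 *\<^sub>R e1)) * (- ((x $ 1 - x0 $ 1) / rho x))) (at 0)" for t x
    by (rule DERIV_square_max_0) (auto simp: m_def intro!: derivative_eq_intros rho_x)
  have m_y: "((\<lambda>h. (max 0 (m t (x + h *\<^sub>R e2)))\<^sup>2) has_real_derivative
      2 * max 0 (m t (x + 0 *\<^sub>R e2)) * (- ((x $ 2 - x0 $ 2) / rho x))) (at 0)" for t x
    by (rule DERIV_square_max_0) (auto simp: m_def intro!: derivative_eq_intros rho_y)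
  define I where "I = (\<lambda>t. LINT x|lborel. P t x)"
  have P_vanish: "P t x = 0" if "t \<ge> 0" "norm x > norm x0 + T0" for t x
    using m_neg[OF that] by (simp add: P_def)
  have contP: "continuous_on UNIV (P t)" if "t \<ge> 0" for t
    unfolding P_def using that by (auto intro!: continuous_intros cm)
  have I': "(I has_real_derivative (LINT x|lborel. S t x)) (at t)" if t: "t > 0" for t
    unfolding I_def
  proof (rule balance_law[where T = "{0<..}" and r = "norm x0 + T0" and P' = P' and
        ?e1.0 = e1 and ?e2.0 = e2 and ?F1.0 = "\<lambda>x. (max 0 (m t x))\<^sup>2 * (ut t x * ux t x)"
        and ?F2.0 = "\<lambda>x. (max 0 (m t x))\<^sup>2 * (ut t x * uy t x)"
        and ?D1.0 = "\<lambda>x. 2 * max 0 (m t x) * (- ((x $ 1 - x0 $ 1) / rho x)) * (ut t x * ux t x)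
          + (max 0 (m t x))\<^sup>2 * (utx t x * ux t x + ut t x * uxx t x)"
        and ?D2.0 = "\<lambda>x. 2 * max 0 (m t x) * (- ((x $ 2 - x0 $ 2) / rho x)) * (ut t x * uy t x)
          + (max 0 (m t x))\<^sup>2 * (uty t x * uy t x + ut t x * uyy t x)"])
    show "((\<lambda>s. P s x) has_real_derivative P' s x) (at s)" if "s \<in> {0<..}" for s x
    proof -
      have "((\<lambda>s. (ut s x)\<^sup>2 + (ux s x)\<^sup>2 + (uy s x)\<^sup>2) has_real_derivative
          2 * (ut s x * utt s x + ux s x * utx s x + uy s x * uty s x)) (at s)"
        using that by (auto intro!: derivative_eq_intros DERIV_t)
      from DERIV_cdivide[OF DERIV_mult[OF m_t this], where c = 2] show ?thesis
        unfolding P_def P'_def by (rule DERIV_cong) (simp add: field_simps)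
    qed
    show "continuous_on ({0<..} \<times> UNIV) (\<lambda>z. P' (fst z) (snd z))"
      unfolding P'_def by (auto intro!: continuous_intros cm)
    show "dir_deriv e1 (\<lambda>x. (max 0 (m t x))\<^sup>2 * (ut t x * ux t x))
        (\<lambda>x. 2 * max 0 (m t x) * (- ((x $ 1 - x0 $ 1) / rho x)) * (ut t x * ux t x)
          + (max 0 (m t x))\<^sup>2 * (utx t x * ux t x + ut t x * uxx t x))"
      unfolding dir_deriv_def
      by (rule allI, rule DERIV_cong, rule DERIV_mult[OF m_x DERIV_mult[OF DERIV_x(2)[OF t] DERIV_x(3)[OF t]]])
        (simp add: algebra_simps)
    show "dir_deriv e2 (\<lambda>x. (max 0 (m t x))\<^sup>2 * (ut t x * uy t x))
        (\<lambda>x. 2 * max 0 (m t x) * (- ((x $ 2 - x0 $ 2) / rho x)) * (ut t x * uy t x)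
          + (max 0 (m t x))\<^sup>2 * (uty t x * uy t x + ut t x * uyy t x))"
      unfolding dir_deriv_def
      by (rule allI, rule DERIV_cong, rule DERIV_mult[OF m_y DERIV_mult[OF DERIV_y(2)[OF t] DERIV_y(4)[OF t]]])
        (simp add: algebra_simps)
    show "P' t x = (2 * max 0 (m t x) * (- ((x $ 1 - x0 $ 1) / rho x)) * (ut t x * ux t x)
          + (max 0 (m t x))\<^sup>2 * (utx t x * ux t x + ut t x * uxx t x)) +
        (2 * max 0 (m t x) * (- ((x $ 2 - x0 $ 2) / rho x)) * (ut t x * uy t x)
          + (max 0 (m t x))\<^sup>2 * (uty t x * uy t x + ut t x * uyy t x)) + S t x" for x
      unfolding P'_def S_def wave_eq[OF t] by (simp add: algebra_simps power2_eq_square)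
    show "continuous_on UNIV (\<lambda>x. 2 * max 0 (m t x) * (- ((x $ 1 - x0 $ 1) / rho x)) * (ut t x * ux t x)
          + (max 0 (m t x))\<^sup>2 * (utx t x * ux t x + ut t x * uxx t x))"
      "continuous_on UNIV (\<lambda>x. 2 * max 0 (m t x) * (- ((x $ 2 - x0 $ 2) / rho x)) * (ut t x * uy t x)
          + (max 0 (m t x))\<^sup>2 * (uty t x * uy t x + ut t x * uyy t x))"
      using t rho_pos by (auto intro!: continuous_intros cm crho simp: less_imp_neq[symmetric])
    show "continuous_on UNIV (\<lambda>x. (max 0 (m t x))\<^sup>2 * (ut t x * ux t x))"
      "continuous_on UNIV (\<lambda>x. (max 0 (m t x))\<^sup>2 * (ut t x * uy t x))"
      using t by (auto intro!: continuous_intros cm)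
    show "(max 0 (m t x))\<^sup>2 * (ut t x * ux t x) = 0" "(max 0 (m t x))\<^sup>2 * (ut t x * uy t x) = 0"
      if "norm x > norm x0 + T0" for x using m_neg[of t x] that t by auto
  qed (use t contP P_vanish in auto)
  \<comment> \<open>The gradient of \<open>rho\<close> has length at most \<open>1\<close>, so the
    flux term is covered by the loss from the shrinking weight.\<close>
  have S_le: "S t x \<le> 0" for t x
  proof -
    have "((x $ 1 - x0 $ 1) / rho x)\<^sup>2 + ((x $ 2 - x0 $ 2) / rho x)\<^sup>2 = ((x $ 1 - x0 $ 1)\<^sup>2 + (x $ 2 - x0 $ 2)\<^sup>2) / (rho x)\<^sup>2"
      by (simp add: power_divide add_divide_distrib)
    also have "\<dots> \<le> 1" using rad[of x] by (simp add: rho_def)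
    finally have "ut t x * ((x $ 1 - x0 $ 1) / rho x * ux t x + (x $ 2 - x0 $ 2) / rho x * uy t x)
        \<le> ((ut t x)\<^sup>2 + (ux t x)\<^sup>2 + (uy t x)\<^sup>2) / 2"
      by (rule flux_le_energy)
    then have "2 * max 0 (m t x) * (ut t x * ((x $ 1 - x0 $ 1) / rho x * ux t x + (x $ 2 - x0 $ 2) / rho x * uy t x))
        \<le> 2 * max 0 (m t x) * (((ut t x)\<^sup>2 + (ux t x)\<^sup>2 + (uy t x)\<^sup>2) / 2)"
      by (rule mult_left_mono) simp
    also have "\<dots> = max 0 (m t x) * ((ut t x)\<^sup>2 + (ux t x)\<^sup>2 + (uy t x)\<^sup>2)" by simp
    finally have "2 * max 0 (m t x) * (ut t x * ((x $ 1 - x0 $ 1) / rho x * ux t x + (x $ 2 - x0 $ 2) / rho x * uy t x))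
        \<le> max 0 (m t x) * ((ut t x)\<^sup>2 + (ux t x)\<^sup>2 + (uy t x)\<^sup>2)" .
    moreover have "(max 0 (m t x))\<^sup>2 * (a x * (ut t x)\<^sup>2) \<ge> 0" using a_nonneg by simp
    ultimately show ?thesis unfolding S_def minus_mult_left[symmetric] by linarith
  qed
  \<comment> \<open>\<open>I'\<close> is known only for \<open>t > 0\<close>; continuity up to
    \<open>0\<close> lets the mean value theorem start from the initial data.\<close>
  have contI: "continuous_on {0..} I"
  proof -
    obtain b where b: "cball 0 (norm x0 + T0) \<subseteq> cbox (-b) (b::real^2)"
      using bounded_subset_cbox_symmetric[OF bounded_cball] by blast
    have "continuous_on {0..} (\<lambda>t. integral (cbox (-b) b) (P t))"
      by (rule integral_continuous_on_param) (auto simp: P_def split_beta intro!: continuous_intros cm)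
    moreover have "integral (cbox (-b) b) (P t) = I t" if "t \<ge> 0" for t
      unfolding I_def
    proof (rule lborel_integral_eq_box_integral[symmetric, OF contP[OF that]])
      show "P t x = 0" if "x \<notin> cbox (-b) b" for x
        using \<open>t \<ge> 0\<close> that b by (intro P_vanish) force+
    qed
    ultimately show ?thesis by (subst continuous_on_cong[OF refl, symmetric]) auto
  qed
  have I0: "I 0 = 0"
  proof -
    \<comment> \<open>Outside the ball of radius \<open>R\<close> the data vanish; inside it the
      weight does, because \<open>rho x\<close> is at least \<open>norm x0 - R\<close>, which is at
      least \<open>T0\<close>.\<close>
    have "P 0 x = 0" for x
    proof (cases "norm x > R")
      case False
      have "norm x0 - norm x \<le> rho x"
        using norm_triangle_ineq2[of x0 x] rho_ge[of x] by (simp add: norm_minus_commute)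
      then have "m 0 x \<le> 0" using False x0 by (simp add: m_def)
      then show ?thesis by (simp add: P_def)
    qed (use initial in \<open>simp add: P_def\<close>)
    then have "P 0 = (\<lambda>x. 0)" by (rule ext)
    then show ?thesis by (simp add: I_def)
  qed
  have "\<exists>l z. 0 < z \<and> z < t \<and> DERIV I z :> l \<and> I t - I 0 = (t - 0) * l"
    by (rule MVT[OF t]) (use contI I' in \<open>auto intro: continuous_on_subset simp: real_differentiable_def\<close>)
  then obtain l z where z: "0 < z" "DERIV I z :> l" "I t - I 0 = t * l" by auto
  have "l = (LINT x|lborel. S z x)" using z(2) I'[OF z(1)] by (rule DERIV_unique)
  also have "\<dots> \<le> 0"
    using Bochner_Integration.integral_nonneg[of lborel "\<lambda>x. - S z x"] S_le by simp
  finally have "I t \<le> 0" using z(3) t I0 by (simp add: mult_nonneg_nonpos)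
  then have le: "(LINT x|lborel. P t x) \<le> 0" by (simp add: I_def)
  have "P t x0 = 0"
  proof (rule continuous_integral_le_0_imp_0[OF contP _ _ le])
    show "P t x \<ge> 0" for x by (simp add: P_def)
    show "P t x = 0" if "norm x > norm x0 + T0" for x using P_vanish[OF _ that] t by simp
  qed (use t in simp)
  \<comment> \<open>At the vertex \<open>rho x0 = d\<close>, so the smoothing leaves the weight
    positive as long as \<open>t + d < T0\<close>.\<close>
  moreover have "m t x0 > 0" using td d by (simp add: m_def rho_def)
  ultimately have "(ut t x0)\<^sup>2 + (ux t x0)\<^sup>2 + (uy t x0)\<^sup>2 = 0" by (simp add: P_def)
  then show "ut t x0 = 0" "ux t x0 = 0" "uy t x0 = 0"
    by (simp_all add: add_nonneg_eq_0_iff)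
qed

text \<open>The cone argument gives the vanishing of the derivatives at all times up to
  \<open>t\<close>; then \<open>u\<close> is constant in time at \<open>x\<close> and equals its
  initial value.\<close>

theorem finite_propagation:
  assumes t: "t > 0" and x: "norm x > R + t"
  shows "u t x = 0" "ut t x = 0" "ux t x = 0" "uy t x = 0"
proof -
  have *: "ut s x = 0 \<and> ux s x = 0 \<and> uy s x = 0" if "0 < s" "s \<le> t" for s
  proof -
    define d where "d = (norm x - R - s) / 2"
    have "d > 0" "s + d < norm x - R" using that x by (auto simp: d_def field_simps)
    then show ?thesis using backward_cone_vanishing[of "norm x - R" x s d] that by auto
  qed
  then show "ut t x = 0" "ux t x = 0" "uy t x = 0" using t by auto
  have "continuous_on {0..t} (\<lambda>s. u s x)" by (auto intro!: continuous_intros)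
  moreover have "DERIV (\<lambda>s. u s x) s :> 0" if "0 < s" "s < t" for s
    using DERIV_t(1)[OF that(1), of x] * that by auto
  ultimately have "u t x = u 0 x"
    using DERIV_isconst_end[OF t, of "\<lambda>s. u s x"] by auto
  then show "u t x = 0" using initial x t by simp
qed

end

subsection \<open>Multiplier identities\<close>

context damped_wave begin

definition energy_dens :: "real \<Rightarrow> real^2 \<Rightarrow> real" where
  "energy_dens t x = ((ut t x)\<^sup>2 + (ux t x)\<^sup>2 + (uy t x)\<^sup>2) / 2"

definition energy_int :: "real \<Rightarrow> real" where
  "energy_int t = (LINT x|lborel. energy_dens t x)"

definition mass_int :: "real \<Rightarrow> real" where
  "mass_int t = (LINT x|lborel. (u t x)\<^sup>2)"

definition damped_mass_int :: "real \<Rightarrow> real" where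
  "damped_mass_int t = (LINT x|lborel. a x * (u t x)\<^sup>2)"

lemma vanishing_integrable:
  fixes f :: "real^2 \<Rightarrow> real"
  assumes "t > 0" and "continuous_on UNIV f"
    and "\<And>x. u t x = 0 \<Longrightarrow> ut t x = 0 \<Longrightarrow> ux t x = 0 \<Longrightarrow> uy t x = 0 \<Longrightarrow> f x = 0"
  shows "integrable lborel f"
  using assms finite_propagation[OF assms(1)]
  by (intro continuous_vanishing_integrable[of f "R + t"]) auto

text \<open>The support condition is stated pointwise, as vanishing wherever \<open>u\<close> and
  its first derivatives vanish, which is immediate for concrete densities. Finite propagation
  converts it into one radius for all times below \<open>t + 1\<close>.\<close>

lemma wave_balance_law:
  fixes P P' :: "real \<Rightarrow> real^2 \<Rightarrow> real"
  assumes t: "t > 0"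
    and P: "\<And>s x. s > 0 \<Longrightarrow> ((\<lambda>s. P s x) has_real_derivative P' s x) (at s)"
    and contP: "\<And>s. s > 0 \<Longrightarrow> continuous_on UNIV (P s)"
    and contP': "continuous_on ({0<..} \<times> UNIV) (\<lambda>z. P' (fst z) (snd z))"
    and suppP: "\<And>s x. u s x = 0 \<Longrightarrow> ut s x = 0 \<Longrightarrow> ux s x = 0 \<Longrightarrow> uy s x = 0 \<Longrightarrow> P s x = 0"
    and F1: "dir_deriv e1 F1 D1" "continuous_on UNIV F1" "continuous_on UNIV D1"
      "\<And>x. u t x = 0 \<Longrightarrow> ut t x = 0 \<Longrightarrow> ux t x = 0 \<Longrightarrow> uy t x = 0 \<Longrightarrow> F1 x = 0"
    and F2: "dir_deriv e2 F2 D2" "continuous_on UNIV F2" "continuous_on UNIV D2"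
      "\<And>x. u t x = 0 \<Longrightarrow> ut t x = 0 \<Longrightarrow> ux t x = 0 \<Longrightarrow> uy t x = 0 \<Longrightarrow> F2 x = 0"
    and eq: "\<And>x. P' t x = D1 x + D2 x + S x"
  shows "((\<lambda>s. LINT x|lborel. P s x) has_real_derivative (LINT x|lborel. S x)) (at t)"
proof (rule balance_law[where T = "{0<..<t+1}" and r = "R + t + 1" and P' = P' and
      ?e1.0 = e1 and ?e2.0 = e2 and ?F1.0 = F1 and ?F2.0 = F2 and ?D1.0 = D1 and ?D2.0 = D2])
  have v: "u s x = 0 \<and> ut s x = 0 \<and> ux s x = 0 \<and> uy s x = 0"
    if "s \<in> {0<..<t+1}" "R + t + 1 < norm x" for s x
    using finite_propagation[of s x] that by auto
  show "P s x = 0" if "s \<in> {0<..<t+1}" "R + t + 1 < norm x" for s x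
    using v[OF that] suppP by auto
  show "F1 x = 0" "F2 x = 0" if "R + t + 1 < norm x" for x
    using v[of t, OF _ that] t F1(4) F2(4) by auto
  show "continuous_on ({0<..<t+1} \<times> UNIV) (\<lambda>z. P' (fst z) (snd z))"
    by (rule continuous_on_subset[OF contP']) auto
qed (use t P contP F1 F2 eq in auto)

text \<open>Multiplier \<open>ut\<close>, with flux \<open>ut grad u\<close>.\<close>

lemma energy_deriv:
  assumes t: "t > 0"
  shows "(energy_int has_real_derivative - (LINT x|lborel. a x * (ut t x)\<^sup>2)) (at t)"
proof -
  have "((\<lambda>t. LINT x|lborel. ((ut t x)\<^sup>2 + (ux t x)\<^sup>2 + (uy t x)\<^sup>2) / 2) has_real_derivative
      (LINT x|lborel. - (a x * (ut t x)\<^sup>2))) (at t)"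
  proof (rule wave_balance_law[OF t, where
        P' = "\<lambda>t x. ut t x * utt t x + ux t x * utx t x + uy t x * uty t x"
        and ?F1.0 = "\<lambda>x. ut t x * ux t x" and ?D1.0 = "\<lambda>x. utx t x * ux t x + ut t x * uxx t x"
        and ?F2.0 = "\<lambda>x. ut t x * uy t x" and ?D2.0 = "\<lambda>x. uty t x * uy t x + ut t x * uyy t x"])
    show "((\<lambda>s. ((ut s x)\<^sup>2 + (ux s x)\<^sup>2 + (uy s x)\<^sup>2) / 2) has_real_derivative
        ut s x * utt s x + ux s x * utx s x + uy s x * uty s x) (at s)" if "s > 0" for s x
      using that by (auto intro!: derivative_eq_intros DERIV_t)
  qed (use t in \<open>auto intro!: continuous_intros derivative_eq_intros DERIV_x DERIV_y
      simp: dir_deriv_def wave_eq algebra_simps power2_eq_square\<close>)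
  then show ?thesis by (simp add: energy_int_def[abs_def] energy_dens_def[abs_def])
qed

text \<open>Multiplier \<open>u\<close>. The damping term \<open>a u ut\<close> is the time
  derivative of \<open>a u^2 / 2\<close> and is therefore placed inside the functional; this is
  where \<open>damped_mass_int\<close> enters the Lyapunov functional.\<close>

lemma mass_multiplier_deriv:
  assumes t: "t > 0"
  shows "((\<lambda>t. LINT x|lborel. ut t x * u t x + a x * (u t x)\<^sup>2 / 2) has_real_derivative
      (LINT x|lborel. (ut t x)\<^sup>2 - (ux t x)\<^sup>2 - (uy t x)\<^sup>2)) (at t)"
proof (rule wave_balance_law[OF t, where
      P' = "\<lambda>t x. utt t x * u t x + (ut t x)\<^sup>2 + a x * (u t x * ut t x)"
      and ?F1.0 = "\<lambda>x. u t x * ux t x" and ?D1.0 = "\<lambda>x. (ux t x)\<^sup>2 + u t x * uxx t x"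
      and ?F2.0 = "\<lambda>x. u t x * uy t x" and ?D2.0 = "\<lambda>x. (uy t x)\<^sup>2 + u t x * uyy t x"])
  show "((\<lambda>s. ut s x * u s x + a x * (u s x)\<^sup>2 / 2) has_real_derivative
      utt s x * u s x + (ut s x)\<^sup>2 + a x * (u s x * ut s x)) (at s)" if "s > 0" for s x
    using that by (auto intro!: derivative_eq_intros DERIV_t simp: power2_eq_square)
qed (use t in \<open>auto intro!: continuous_intros derivative_eq_intros DERIV_x DERIV_y
    simp: dir_deriv_def wave_eq algebra_simps power2_eq_square\<close>)

text \<open>Multiplier \<open>h . grad u\<close> for a field \<open>h = (h1, h2)\<close> with
  symmetric Jacobian. The flux is \<open>(h . grad u) grad u\<close> plus half of \<open>h\<close>
  times \<open>ut^2 - |grad u|^2\<close>; the divergence and the Jacobian of \<open>h\<close> remain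
  as source.\<close>

lemma morawetz_multiplier_deriv:
  assumes t: "t > 0"
    and h: "dir_deriv e1 h1 h11" "dir_deriv e2 h1 h12" "dir_deriv e1 h2 h12" "dir_deriv e2 h2 h22"
    and ch: "continuous_on UNIV h1" "continuous_on UNIV h2" "continuous_on UNIV h11"
      "continuous_on UNIV h12" "continuous_on UNIV h22"
  shows "((\<lambda>t. LINT x|lborel. ut t x * (h1 x * ux t x + h2 x * uy t x)) has_real_derivative
      - (LINT x|lborel. a x * ut t x * (h1 x * ux t x + h2 x * uy t x)
          + (h11 x + h22 x) * ((ut t x)\<^sup>2 - (ux t x)\<^sup>2 - (uy t x)\<^sup>2) / 2
          + (h11 x * (ux t x)\<^sup>2 + 2 * h12 x * ux t x * uy t x + h22 x * (uy t x)\<^sup>2))) (at t)"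
proof -
  note [continuous_intros] = ch[THEN continuous_on_compose2, OF _ subset_UNIV]
  have hx: "((\<lambda>h. h1 (x + h *\<^sub>R e1)) has_real_derivative h11 x) (at 0)"
    "((\<lambda>h. h2 (x + h *\<^sub>R e1)) has_real_derivative h12 x) (at 0)"
    "((\<lambda>h. h1 (x + h *\<^sub>R e2)) has_real_derivative h12 x) (at 0)"
    "((\<lambda>h. h2 (x + h *\<^sub>R e2)) has_real_derivative h22 x) (at 0)" for x
    using h by (auto simp: dir_deriv_def)
  let ?hg = "\<lambda>x. h1 x * ux t x + h2 x * uy t x"
  let ?l = "\<lambda>x. (ut t x)\<^sup>2 - (ux t x)\<^sup>2 - (uy t x)\<^sup>2"
  have "((\<lambda>t. LINT x|lborel. ut t x * (h1 x * ux t x + h2 x * uy t x)) has_real_derivative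
      (LINT x|lborel. - (a x * ut t x * (h1 x * ux t x + h2 x * uy t x)
          + (h11 x + h22 x) * ((ut t x)\<^sup>2 - (ux t x)\<^sup>2 - (uy t x)\<^sup>2) / 2
          + (h11 x * (ux t x)\<^sup>2 + 2 * h12 x * ux t x * uy t x + h22 x * (uy t x)\<^sup>2)))) (at t)"
  proof (rule wave_balance_law[OF t, where
      P' = "\<lambda>t x. utt t x * (h1 x * ux t x + h2 x * uy t x) + ut t x * (h1 x * utx t x + h2 x * uty t x)"
      and ?F1.0 = "\<lambda>x. ux t x * ?hg x + h1 x * ?l x / 2"
      and ?D1.0 = "\<lambda>x. uxx t x * ?hg x
        + ux t x * (h11 x * ux t x + h1 x * uxx t x + h12 x * uy t x + h2 x * uxy t x)
        + (h11 x * ?l x / 2 + h1 x * (ut t x * utx t x - ux t x * uxx t x - uy t x * uxy t x))"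
      and ?F2.0 = "\<lambda>x. uy t x * ?hg x + h2 x * ?l x / 2"
      and ?D2.0 = "\<lambda>x. uyy t x * ?hg x
        + uy t x * (h12 x * ux t x + h1 x * uxy t x + h22 x * uy t x + h2 x * uyy t x)
        + (h22 x * ?l x / 2 + h2 x * (ut t x * uty t x - ux t x * uxy t x - uy t x * uyy t x))"])
    show "((\<lambda>s. ut s x * (h1 x * ux s x + h2 x * uy s x)) has_real_derivative
      utt s x * (h1 x * ux s x + h2 x * uy s x) + ut s x * (h1 x * utx s x + h2 x * uty s x)) (at s)"
      if "s > 0" for s x
      using that by (auto intro!: derivative_eq_intros DERIV_t simp: algebra_simps)
    show "dir_deriv e1 (\<lambda>x. ux t x * ?hg x + h1 x * ?l x / 2) (\<lambda>x. uxx t x * ?hg x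
        + ux t x * (h11 x * ux t x + h1 x * uxx t x + h12 x * uy t x + h2 x * uxy t x)
        + (h11 x * ?l x / 2 + h1 x * (ut t x * utx t x - ux t x * uxx t x - uy t x * uxy t x)))"
      unfolding dir_deriv_def using t
      by (auto intro!: derivative_eq_intros DERIV_x hx simp: field_simps)
    show "dir_deriv e2 (\<lambda>x. uy t x * ?hg x + h2 x * ?l x / 2) (\<lambda>x. uyy t x * ?hg x
        + uy t x * (h12 x * ux t x + h1 x * uxy t x + h22 x * uy t x + h2 x * uyy t x)
        + (h22 x * ?l x / 2 + h2 x * (ut t x * uty t x - ux t x * uxy t x - uy t x * uyy t x)))"
      unfolding dir_deriv_def using t
      by (auto intro!: derivative_eq_intros DERIV_y hx simp: field_simps)
  qed (use t in \<open>auto intro!: continuous_intros simp: wave_eq field_simps power2_eq_square\<close>)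
  then show ?thesis by (simp only: Bochner_Integration.integral_minus)
qed

text \<open>The integrand is the divergence of \<open>u^2 h\<close>. Adding it trades mass where
  \<open>div h\<close> is large for gradient terms.\<close>

lemma integral_multiplier_mass_eq_0:
  assumes t: "t > 0"
    and h: "dir_deriv e1 h1 h11" "dir_deriv e2 h2 h22"
    and ch: "continuous_on UNIV h1" "continuous_on UNIV h2" "continuous_on UNIV h11" "continuous_on UNIV h22"
  shows "(LINT x|lborel. (h11 x + h22 x) * (u t x)\<^sup>2 + 2 * u t x * (h1 x * ux t x + h2 x * uy t x)) = 0"
proof -
  note [continuous_intros] = ch[THEN continuous_on_compose2, OF _ subset_UNIV]
  have hx: "((\<lambda>h. h1 (x + h *\<^sub>R e1)) has_real_derivative h11 x) (at 0)"
    "((\<lambda>h. h2 (x + h *\<^sub>R e2)) has_real_derivative h22 x) (at 0)" for x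
    using h by (auto simp: dir_deriv_def)
  let ?D1 = "\<lambda>x. h11 x * (u t x)\<^sup>2 + 2 * u t x * (h1 x * ux t x)"
  let ?D2 = "\<lambda>x. h22 x * (u t x)\<^sup>2 + 2 * u t x * (h2 x * uy t x)"
  have "(LINT x|lborel. ?D1 x) = 0"
    by (rule integral_dir_deriv_eq_0[of e1 "\<lambda>x. h1 x * (u t x)\<^sup>2" _ "R + t"])
      (use t in \<open>auto intro!: continuous_intros derivative_eq_intros hx DERIV_x
        simp: dir_deriv_def finite_propagation algebra_simps\<close>)
  moreover have "(LINT x|lborel. ?D2 x) = 0"
    by (rule integral_dir_deriv_eq_0[of e2 "\<lambda>x. h2 x * (u t x)\<^sup>2" _ "R + t"])
      (use t in \<open>auto intro!: continuous_intros derivative_eq_intros hx DERIV_y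
        simp: dir_deriv_def finite_propagation algebra_simps\<close>)
  moreover have "(LINT x|lborel. ?D1 x + ?D2 x) = (LINT x|lborel. ?D1 x) + (LINT x|lborel. ?D2 x)"
    by (intro Bochner_Integration.integral_add vanishing_integrable[OF t])
      (use t in \<open>auto intro!: continuous_intros\<close>)
  ultimately show ?thesis by (simp add: algebra_simps)
qed

end

subsection \<open>The multiplier field\<close>

lemma axis_components [simp]: "e1 $ 1 = 1" "e1 $ 2 = 0" "e2 $ 1 = 0" "e2 $ 2 = 1"
  by (simp_all add: axis_def)

text \<open>The Morawetz field \<open>x\<close> is replaced by the bounded field \<open>phi M x *\<^sub>R x\<close>, which is close to \<open>x\<close> on
  balls of radius much smaller than \<open>M\<close>.\<close>

definition phi :: "real \<Rightarrow> real^2 \<Rightarrow> real" where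
  "phi M x = M / sqrt (M\<^sup>2 + (x $ 1)\<^sup>2 + (x $ 2)\<^sup>2)"

lemma radicand_pos: "M > 0 \<Longrightarrow> M\<^sup>2 + (y::real)\<^sup>2 + (z::real)\<^sup>2 > 0"
  by (simp add: add_pos_nonneg)

lemma phi_pos: "M > 0 \<Longrightarrow> phi M x > 0"
  using radicand_pos[of M] by (simp add: phi_def)

text \<open>Free of the square root, this identity trades \<open>|x|^2\<close> for powers of
  \<open>phi\<close>.\<close>

lemma phi_identity: "M > 0 \<Longrightarrow> (phi M x)\<^sup>2 * (M\<^sup>2 + (x $ 1)\<^sup>2 + (x $ 2)\<^sup>2) = M\<^sup>2"
  using radicand_pos[of M "x $ 1" "x $ 2"] by (simp add: phi_def power_divide)

lemma phi_le_1: "M > 0 \<Longrightarrow> phi M x \<le> 1"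
proof -
  assume M: "M > 0"
  have "(phi M x)\<^sup>2 \<le> 1\<^sup>2"
    using radicand_pos[OF M, of "x $ 1" "x $ 2"] by (simp add: phi_def power_divide)
  then show ?thesis by (rule power2_le_imp_le) simp
qed

lemma DERIV_phi:
  assumes "M > 0"
  shows "((\<lambda>h. phi M (x + h *\<^sub>R e1)) has_real_derivative - (x $ 1 * phi M x ^ 3 / M\<^sup>2)) (at 0)"
    and "((\<lambda>h. phi M (x + h *\<^sub>R e2)) has_real_derivative - (x $ 2 * phi M x ^ 3 / M\<^sup>2)) (at 0)"
proof -
  define r where "r = sqrt (M\<^sup>2 + (x $ 1)\<^sup>2 + (x $ 2)\<^sup>2)"
  have r: "r > 0" using radicand_pos[OF assms] by (simp add: r_def)
  have 1: "((\<lambda>h. sqrt (M\<^sup>2 + (x $ 1 + h)\<^sup>2 + (x $ 2)\<^sup>2)) has_real_derivative x $ 1 / r) (at 0)"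
    using radicand_pos[OF assms, of "x $ 1" "x $ 2"]
    by (auto intro!: derivative_eq_intros simp: r_def field_simps)
  have 2: "((\<lambda>h. sqrt (M\<^sup>2 + (x $ 1)\<^sup>2 + (x $ 2 + h)\<^sup>2)) has_real_derivative x $ 2 / r) (at 0)"
    using radicand_pos[OF assms, of "x $ 1" "x $ 2"]
    by (auto intro!: derivative_eq_intros simp: r_def field_simps)
  have alg: "- (M * (y / r)) / (r * r) = - (y * (M / r) ^ 3 / M\<^sup>2)" for y
    using r assms by (simp add: field_simps power2_eq_square power3_eq_cube)
  show "((\<lambda>h. phi M (x + h *\<^sub>R e1)) has_real_derivative - (x $ 1 * phi M x ^ 3 / M\<^sup>2)) (at 0)"
    unfolding phi_def coord_line r_def[symmetric]
    by (rule DERIV_cong, rule DERIV_divide[OF DERIV_const 1])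
      (use r alg in \<open>auto simp: r_def\<close>)
  show "((\<lambda>h. phi M (x + h *\<^sub>R e2)) has_real_derivative - (x $ 2 * phi M x ^ 3 / M\<^sup>2)) (at 0)"
    unfolding phi_def coord_line r_def[symmetric]
    by (rule DERIV_cong, rule DERIV_divide[OF DERIV_const 2])
      (use r alg in \<open>auto simp: r_def\<close>)
qed

lemma continuous_on_phi: "M > 0 \<Longrightarrow> continuous_on A (phi M)"
  unfolding phi_def[abs_def]
  by (intro continuous_intros) (use radicand_pos[of M] in \<open>simp add: less_imp_neq[symmetric]\<close>)

text \<open>Jacobian of the field \<open>phi M x *\<^sub>R x\<close>. The field is the gradient of
  \<open>M * sqrt (M^2 + |x|^2)\<close>, so this is a Hessian and one off-diagonal entry
  suffices.\<close>

definition jac11 :: "real \<Rightarrow> real^2 \<Rightarrow> real" where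
  "jac11 M x = phi M x - (x $ 1)\<^sup>2 * phi M x ^ 3 / M\<^sup>2"
definition jac12 :: "real \<Rightarrow> real^2 \<Rightarrow> real" where
  "jac12 M x = - (x $ 1 * x $ 2 * phi M x ^ 3 / M\<^sup>2)"
definition jac22 :: "real \<Rightarrow> real^2 \<Rightarrow> real" where
  "jac22 M x = phi M x - (x $ 2)\<^sup>2 * phi M x ^ 3 / M\<^sup>2"

lemma dir_deriv_multiplier:
  assumes "M > 0"
  shows "dir_deriv e1 (\<lambda>x. x $ 1 * phi M x) (jac11 M)" "dir_deriv e2 (\<lambda>x. x $ 1 * phi M x) (jac12 M)"
    "dir_deriv e1 (\<lambda>x. x $ 2 * phi M x) (jac12 M)" "dir_deriv e2 (\<lambda>x. x $ 2 * phi M x) (jac22 M)"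
  unfolding dir_deriv_def jac11_def jac12_def jac22_def
  by (auto intro!: derivative_eq_intros DERIV_phi assms simp: power2_eq_square algebra_simps)

lemma continuous_multiplier:
  assumes "M > 0"
  shows "continuous_on UNIV (\<lambda>x. x $ 1 * phi M x)" "continuous_on UNIV (\<lambda>x. x $ 2 * phi M x)"
    "continuous_on UNIV (jac11 M)" "continuous_on UNIV (jac12 M)" "continuous_on UNIV (jac22 M)"
  unfolding jac11_def[abs_def] jac12_def[abs_def] jac22_def[abs_def]
  using assms by (auto intro!: continuous_intros continuous_on_phi)

text \<open>The Jacobian has eigenvalue \<open>phi^3\<close> in the radial and \<open>phi\<close> in
  the tangential direction; this is the trace.\<close>

lemma div_multiplier:
  assumes "M > 0"
  shows "jac11 M x + jac22 M x = phi M x + phi M x ^ 3"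
proof -
  have "phi M x * ((phi M x)\<^sup>2 * (M\<^sup>2 + (x $ 1)\<^sup>2 + (x $ 2)\<^sup>2)) = phi M x * M\<^sup>2"
    by (simp add: phi_identity[OF assms])
  then have "phi M x ^ 3 * ((x $ 1)\<^sup>2 + (x $ 2)\<^sup>2) = (phi M x - phi M x ^ 3) * M\<^sup>2"
    by (simp add: power3_eq_cube power2_eq_square algebra_simps)
  then have "((x $ 1)\<^sup>2 * phi M x ^ 3 + (x $ 2)\<^sup>2 * phi M x ^ 3) / M\<^sup>2 = phi M x - phi M x ^ 3"
    using assms by (simp add: field_simps)
  then show ?thesis by (simp add: jac11_def jac22_def add_divide_distrib)
qed

text \<open>The field has length at most \<open>M\<close>, by \<open>phi_identity\<close>; the rest
  is Cauchy-Schwarz.\<close>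

lemma multiplier_norm_sq_le:
  assumes "M > 0"
  shows "(x $ 1 * phi M x * p + x $ 2 * phi M x * q)\<^sup>2 \<le> M\<^sup>2 * (p\<^sup>2 + q\<^sup>2)"
proof -
  have "(x $ 1 * p + x $ 2 * q)\<^sup>2 \<le> ((x $ 1)\<^sup>2 + (x $ 2)\<^sup>2) * (p\<^sup>2 + q\<^sup>2)"
    using zero_le_power2[of "x $ 1 * q - x $ 2 * p"] by (simp add: algebra_simps power2_eq_square)
  then have "(phi M x)\<^sup>2 * (x $ 1 * p + x $ 2 * q)\<^sup>2 \<le> (phi M x)\<^sup>2 * (((x $ 1)\<^sup>2 + (x $ 2)\<^sup>2) * (p\<^sup>2 + q\<^sup>2))"
    by (rule mult_left_mono) simp
  also have "\<dots> = ((phi M x)\<^sup>2 * ((x $ 1)\<^sup>2 + (x $ 2)\<^sup>2)) * (p\<^sup>2 + q\<^sup>2)" by simp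
  also have "\<dots> \<le> M\<^sup>2 * (p\<^sup>2 + q\<^sup>2)"
  proof (rule mult_right_mono)
    have "(phi M x)\<^sup>2 * ((x $ 1)\<^sup>2 + (x $ 2)\<^sup>2) = M\<^sup>2 - (phi M x)\<^sup>2 * M\<^sup>2"
      using phi_identity[OF assms, of x] by (simp add: algebra_simps)
    then show "(phi M x)\<^sup>2 * ((x $ 1)\<^sup>2 + (x $ 2)\<^sup>2) \<le> M\<^sup>2" by simp
  qed simp
  finally have "(phi M x)\<^sup>2 * (x $ 1 * p + x $ 2 * q)\<^sup>2 \<le> M\<^sup>2 * (p\<^sup>2 + q\<^sup>2)" .
  moreover have "(x $ 1 * phi M x * p + x $ 2 * phi M x * q)\<^sup>2 = (phi M x)\<^sup>2 * (x $ 1 * p + x $ 2 * q)\<^sup>2"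
    by (simp add: power2_eq_square algebra_simps)
  ultimately show ?thesis by simp
qed

text \<open>Since \<open>phi \<le> 1\<close>, the radial eigenvalue \<open>phi^3\<close> is the
  smaller one.\<close>

lemma jacobian_ge:
  assumes "M > 0"
  shows "jac11 M x * p\<^sup>2 + 2 * jac12 M x * p * q + jac22 M x * q\<^sup>2 \<ge> phi M x ^ 3 * (p\<^sup>2 + q\<^sup>2)"
proof -
  have "phi M x * (x $ 1 * phi M x * p + x $ 2 * phi M x * q)\<^sup>2
      = phi M x ^ 3 * ((x $ 1)\<^sup>2 * p\<^sup>2 + 2 * x $ 1 * x $ 2 * p * q + (x $ 2)\<^sup>2 * q\<^sup>2)"
    by (simp add: power2_eq_square power3_eq_cube algebra_simps)
  moreover have "(x $ 1 * phi M x * p + x $ 2 * phi M x * q)\<^sup>2 \<le> ((phi M x)\<^sup>2 * ((x $ 1)\<^sup>2 + (x $ 2)\<^sup>2)) * (p\<^sup>2 + q\<^sup>2)"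
    using mult_left_mono[OF zero_le_power2[of "x $ 1 * q - x $ 2 * p"], of "(phi M x)\<^sup>2"]
    by (simp add: algebra_simps power2_eq_square)
  then have "phi M x * (x $ 1 * phi M x * p + x $ 2 * phi M x * q)\<^sup>2 \<le> phi M x * ((M\<^sup>2 - (phi M x)\<^sup>2 * M\<^sup>2) * (p\<^sup>2 + q\<^sup>2))"
  proof -
    have "(phi M x)\<^sup>2 * ((x $ 1)\<^sup>2 + (x $ 2)\<^sup>2) = M\<^sup>2 - (phi M x)\<^sup>2 * M\<^sup>2"
      using phi_identity[OF assms, of x] by (simp add: algebra_simps)
    then show "(x $ 1 * phi M x * p + x $ 2 * phi M x * q)\<^sup>2 \<le> ((phi M x)\<^sup>2 * ((x $ 1)\<^sup>2 + (x $ 2)\<^sup>2)) * (p\<^sup>2 + q\<^sup>2) \<Longrightarrow> ?thesis"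
      using phi_pos[OF assms, of x] by simp
  qed
  moreover have "phi M x * ((M\<^sup>2 - (phi M x)\<^sup>2 * M\<^sup>2) * (p\<^sup>2 + q\<^sup>2)) = M\<^sup>2 * ((phi M x - phi M x ^ 3) * (p\<^sup>2 + q\<^sup>2))"
    by (simp add: algebra_simps power2_eq_square power3_eq_cube)
  ultimately have *: "phi M x ^ 3 * ((x $ 1)\<^sup>2 * p\<^sup>2 + 2 * x $ 1 * x $ 2 * p * q + (x $ 2)\<^sup>2 * q\<^sup>2)
      \<le> M\<^sup>2 * ((phi M x - phi M x ^ 3) * (p\<^sup>2 + q\<^sup>2))"
    by simp
  have "jac11 M x * p\<^sup>2 + 2 * jac12 M x * p * q + jac22 M x * q\<^sup>2 = phi M x * (p\<^sup>2 + q\<^sup>2)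
      - phi M x ^ 3 * ((x $ 1)\<^sup>2 * p\<^sup>2 + 2 * x $ 1 * x $ 2 * p * q + (x $ 2)\<^sup>2 * q\<^sup>2) / M\<^sup>2"
    by (simp add: jac11_def jac12_def jac22_def algebra_simps add_divide_distrib)
  also have "\<dots> \<ge> phi M x * (p\<^sup>2 + q\<^sup>2) - (phi M x - phi M x ^ 3) * (p\<^sup>2 + q\<^sup>2)"
    using * assms by (simp add: divide_le_eq mult.commute)
  finally show ?thesis by (simp add: algebra_simps)
qed

text \<open>The choice \<open>M = 3 * L\<close> gives \<open>9 L^2 / (9 L^2 + L^2)\<close>. It
  yields \<open>phi + phi^3 \<ge> 171/100\<close> in the ball, just above the
  \<open>2 * (3/4 + 1/10)\<close> that the coercivity estimate asks for.\<close>

lemma phi_sq_ge: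
  assumes "L > 0" "norm x \<le> L"
  shows "(phi (3 * L) x)\<^sup>2 \<ge> 9 / 10"
proof -
  have "(x $ 1)\<^sup>2 + (x $ 2)\<^sup>2 \<le> L\<^sup>2"
    using assms by (simp add: norm_eq_coords[symmetric])
  moreover have "(phi (3 * L) x)\<^sup>2 = (9 * L\<^sup>2) / (9 * L\<^sup>2 + ((x $ 1)\<^sup>2 + (x $ 2)\<^sup>2))"
    using radicand_pos[of "3 * L" "x $ 1" "x $ 2"] assms
    by (simp add: phi_def power_divide power_mult_distrib add.assoc)
  moreover have "L\<^sup>2 > 0" using assms by simp
  moreover have "9 / 10 \<le> (9 * L\<^sup>2) / (9 * L\<^sup>2 + s)" if "0 \<le> s" "s \<le> L\<^sup>2" for s
  proof -
    have "9 * L\<^sup>2 + s > 0" using that(1) \<open>L\<^sup>2 > 0\<close> by linarith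
    then show ?thesis using that by (simp add: le_divide_eq)
  qed
  ultimately show ?thesis by simp
qed

text \<open>Inside the ball of radius \<open>L\<close> the
  divergence of the multiplier field exceeds \<open>2 * (3 / 4)\<close>; outside the damping takes over.\<close>

lemma multiplier_coercive:
  fixes A p q :: real
  assumes L: "L > 0" and eps: "eps > 0" and al: "0 \<le> al" "al \<le> B" and out: "norm x > L \<longrightarrow> al \<ge> eps"
    and K: "K \<ge> 18 * B * L\<^sup>2 + 1 / eps"
  shows "A\<^sup>2 + p\<^sup>2 + q\<^sup>2 \<le> 10 * (al * A * (x $ 1 * phi (3 * L) x * p + x $ 2 * phi (3 * L) x * q)
      + (jac11 (3 * L) x + jac22 (3 * L) x) * (A\<^sup>2 - p\<^sup>2 - q\<^sup>2) / 2
      + (jac11 (3 * L) x * p\<^sup>2 + 2 * jac12 (3 * L) x * p * q + jac22 (3 * L) x * q\<^sup>2)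
      - 3 / 4 * (A\<^sup>2 - p\<^sup>2 - q\<^sup>2) + K * (al * A\<^sup>2))"
proof -
  define M where "M = 3 * L"
  define f where "f = phi M x"
  define g where "g = x $ 1 * phi M x * p + x $ 2 * phi M x * q"
  define N where "N = p\<^sup>2 + q\<^sup>2"
  have M: "M > 0" "M\<^sup>2 = 9 * L\<^sup>2" using L by (auto simp: M_def power_mult_distrib)
  have N: "N \<ge> 0" by (simp add: N_def)
  have f: "0 < f" "f \<le> 1" using phi_pos[OF M(1)] phi_le_1[OF M(1)] by (auto simp: f_def)
  \<comment> \<open>Young's inequality with weight \<open>8 * M\<^sup>2\<close>, chosen to spend
    only \<open>N / 8\<close>; then \<open>al * al \<le> B * al\<close> and
    \<open>2 * M\<^sup>2 = 18 * L\<^sup>2\<close> explain the term \<open>18 * B * L\<^sup>2\<close>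
    in \<open>K\<close>.\<close>
  have cross: "al * A * g \<ge> - (18 * B * L\<^sup>2 * (al * A\<^sup>2)) - N / 8"
  proof -
    have "g\<^sup>2 / (8 * M\<^sup>2) \<le> N / 8"
      using multiplier_norm_sq_le[OF M(1), of x p q] M(1) by (simp add: g_def N_def divide_le_eq mult.commute)
    moreover have "0 \<le> (4 * M\<^sup>2 * al * A + g)\<^sup>2 / (8 * M\<^sup>2)" by simp
    moreover have "(4 * M\<^sup>2 * al * A + g)\<^sup>2 / (8 * M\<^sup>2) = 2 * M\<^sup>2 * (al * al * A\<^sup>2) + al * A * g + g\<^sup>2 / (8 * M\<^sup>2)"
      using M(1) by (simp add: field_simps power2_eq_square)
    moreover have "2 * M\<^sup>2 * (al * al * A\<^sup>2) \<le> 2 * M\<^sup>2 * (B * al * A\<^sup>2)"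
      using al by (intro mult_left_mono mult_right_mono) auto
    ultimately have "0 \<le> 2 * M\<^sup>2 * (B * al * A\<^sup>2) + al * A * g + N / 8" by linarith
    moreover have "2 * M\<^sup>2 * (B * al * A\<^sup>2) = 18 * B * L\<^sup>2 * (al * A\<^sup>2)" by (simp add: M(2))
    ultimately show ?thesis by linarith
  qed
  \<comment> \<open>Half of this bounds the gap between the mean Jacobian eigenvalue and the
    smallest one.\<close>
  have cubic: "f - f ^ 3 \<le> 1 / 2"
  proof -
    have "0 \<le> (f - (1 - f\<^sup>2))\<^sup>2" by simp
    then have "2 * (f - f ^ 3) \<le> f\<^sup>2 + (1 - f\<^sup>2)\<^sup>2"
      by (simp add: power2_eq_square power3_eq_cube algebra_simps)
    also have "\<dots> \<le> 1"
    proof -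
      have "f\<^sup>2 \<le> 1" using f by (simp add: power_le_one)
      then have "(1 - f\<^sup>2) * (1 - f\<^sup>2) \<le> 1 * (1 - f\<^sup>2)" using f by (intro mult_right_mono) auto
      then show ?thesis by (simp add: power2_eq_square)
    qed
    finally show ?thesis by simp
  qed
  \<comment> \<open>\<open>5/8\<close> is the \<open>3/4\<close> from the multiplier
    \<open>u\<close> minus the \<open>1/8\<close> spent on the cross term; the gap costs at most
    another \<open>1/4\<close>, everywhere in the plane.\<close>
  have grad: "3 / 8 * N \<le> (5 / 8 - (f + f ^ 3) / 2 + f ^ 3) * N"
  proof (rule mult_right_mono[OF _ N])
    show "3 / 8 \<le> 5 / 8 - (f + f ^ 3) / 2 + f ^ 3"
      using cubic unfolding add_divide_distrib by linarith
  qed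
  \<comment> \<open>Inside the ball \<open>phi\<close> beats \<open>3/4\<close>; outside, the
    damping term contributes at least \<open>1\<close> through the \<open>1 / eps\<close> in
    \<open>K\<close>.\<close>
  have kin: "1 / 10 * A\<^sup>2 \<le> ((f + f ^ 3) / 2 - 3 / 4 + (K - 18 * B * L\<^sup>2) * al) * A\<^sup>2"
  proof (rule mult_right_mono)
    have Kal: "(K - 18 * B * L\<^sup>2) * al \<ge> 1 / eps * al"
      using K al by (intro mult_right_mono) auto
    show "1 / 10 \<le> (f + f ^ 3) / 2 - 3 / 4 + (K - 18 * B * L\<^sup>2) * al"
    proof (cases "norm x \<le> L")
      case True
      have f2: "f\<^sup>2 \<ge> 9 / 10" using phi_sq_ge[OF L True] by (simp add: f_def M_def)
      have "f\<^sup>2 \<le> f" using f by (simp add: power2_eq_square mult_left_le)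
      then have f1: "f \<ge> 9 / 10" using f2 by simp
      have "f * f\<^sup>2 \<ge> (9 / 10) * (9 / 10)" using f1 f2 by (intro mult_mono) auto
      then have "f ^ 3 \<ge> 81 / 100" by (simp add: power3_eq_cube power2_eq_square)
      moreover have "1 / eps * al \<ge> 0" using eps al by simp
      ultimately show ?thesis using f1 Kal unfolding add_divide_distrib by linarith
    next
      case False
      then have "1 / eps * al \<ge> 1" using out eps by (simp add: divide_simps)
      moreover have "f ^ 3 > 0" using f by simp
      ultimately show ?thesis using Kal f unfolding add_divide_distrib by linarith
    qed
  qed simp
  have jac: "jac11 M x * p\<^sup>2 + 2 * jac12 M x * p * q + jac22 M x * q\<^sup>2 \<ge> f ^ 3 * N"
    using jacobian_ge[OF M(1)] by (simp add: f_def N_def)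
  have dv: "jac11 M x + jac22 M x = f + f ^ 3"
    by (simp add: div_multiplier[OF M(1)] f_def)
  have "al * A * g + (f + f ^ 3) * (A\<^sup>2 - N) / 2 + f ^ 3 * N - 3 / 4 * (A\<^sup>2 - N) + K * (al * A\<^sup>2)
      = (al * A * g + 18 * B * L\<^sup>2 * (al * A\<^sup>2) + N / 8)
        + (5 / 8 - (f + f ^ 3) / 2 + f ^ 3) * N
        + ((f + f ^ 3) / 2 - 3 / 4 + (K - 18 * B * L\<^sup>2) * al) * A\<^sup>2"
    by (simp add: field_simps)
  also have "\<dots> \<ge> 3 / 8 * N + 1 / 10 * A\<^sup>2"
    using cross grad kin by linarith
  finally have "3 / 8 * N + 1 / 10 * A\<^sup>2 \<le> al * A * g + (f + f ^ 3) * (A\<^sup>2 - N) / 2 + f ^ 3 * N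
      - 3 / 4 * (A\<^sup>2 - N) + K * (al * A\<^sup>2)" .
  moreover have "1 / 10 * (A\<^sup>2 + N) \<le> 3 / 8 * N + 1 / 10 * A\<^sup>2" using N by (simp add: field_simps)
  ultimately have "1 / 10 * (A\<^sup>2 + N) \<le> al * A * g + (f + f ^ 3) * (A\<^sup>2 - N) / 2
      + (jac11 M x * p\<^sup>2 + 2 * jac12 M x * p * q + jac22 M x * q\<^sup>2)
      - 3 / 4 * (A\<^sup>2 - N) + K * (al * A\<^sup>2)"
    using jac by linarith
  moreover have eqs: "A\<^sup>2 - p\<^sup>2 - q\<^sup>2 = A\<^sup>2 - N" "A\<^sup>2 + p\<^sup>2 + q\<^sup>2 = A\<^sup>2 + N" by (simp_all add: N_def)
  have "a \<le> 10 * b" if "1 / 10 * a \<le> b" for a b :: real using that by simp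
  ultimately show ?thesis
    unfolding M_def[symmetric] g_def[symmetric] dv eqs by blast
qed

text \<open>The last bracket is the divergence of \<open>v^2 phi x\<close> when
  \<open>(p, q) = grad v\<close>. In the ball it contributes at least \<open>3/2 v^2\<close> against
  the cross term, half of \<open>v^2\<close> being spent on absorbing \<open>2 v g\<close> into
  \<open>2 g^2\<close>; outside, the damping term provides \<open>2 v^2\<close>.\<close>

lemma multiplier_mass_bound:
  fixes v p q :: real
  assumes L: "L > 0" and eps: "eps > 0" and al: "0 \<le> al" and out: "norm x > L \<longrightarrow> al \<ge> eps"
  shows "v\<^sup>2 \<le> 36 * L\<^sup>2 * ((p\<^sup>2 + q\<^sup>2) / 2) + 2 / eps * (al * v\<^sup>2)
      + ((jac11 (3 * L) x + jac22 (3 * L) x) * v\<^sup>2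
        + 2 * v * (x $ 1 * phi (3 * L) x * p + x $ 2 * phi (3 * L) x * q))"
proof -
  define M where "M = 3 * L"
  define f where "f = phi M x"
  define g where "g = x $ 1 * phi M x * p + x $ 2 * phi M x * q"
  have M: "M > 0" "M\<^sup>2 = 9 * L\<^sup>2" using L by (auto simp: M_def power_mult_distrib)
  have f: "0 < f" "f \<le> 1" using phi_pos[OF M(1)] phi_le_1[OF M(1)] by (auto simp: f_def)
  have g: "g\<^sup>2 \<le> 9 * L\<^sup>2 * (p\<^sup>2 + q\<^sup>2)"
    using multiplier_norm_sq_le[OF M(1), of x p q] M(2) by (simp add: g_def)
  have "0 \<le> (v + g)\<^sup>2" by simp
  then have young1: "2 * v * g \<ge> - v\<^sup>2 - g\<^sup>2"
    by (simp add: power2_eq_square algebra_simps)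
  have main: "v\<^sup>2 \<le> 2 * g\<^sup>2 + 2 / eps * (al * v\<^sup>2) + ((f + f ^ 3) * v\<^sup>2 + 2 * v * g)"
  proof (cases "norm x \<le> L")
    case True
    have f2: "f\<^sup>2 \<ge> 9 / 10" using phi_sq_ge[OF L True] by (simp add: f_def M_def)
    have "f\<^sup>2 \<le> f" using f by (simp add: power2_eq_square mult_left_le)
    then have f1: "f \<ge> 9 / 10" using f2 by simp
    have "f * f\<^sup>2 \<ge> (9 / 10) * (9 / 10)" using f1 f2 by (intro mult_mono) auto
    then have "f + f ^ 3 \<ge> 3 / 2" using f1 by (simp add: power3_eq_cube power2_eq_square)
    then have "(f + f ^ 3) * v\<^sup>2 \<ge> 3 / 2 * v\<^sup>2" by (rule mult_right_mono) simp
    moreover have "2 / eps * (al * v\<^sup>2) \<ge> 0" using eps al by simp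
    moreover have "2 * g\<^sup>2 + v\<^sup>2 / 2 + 2 * v * g \<ge> 0"
      using zero_le_power2[of "v + 2 * g"] by (simp add: power2_eq_square algebra_simps)
    ultimately show ?thesis by linarith
  next
    case False
    then have "2 / eps * al \<ge> 2" using out eps by (simp add: divide_simps)
    then have "(2 / eps * al) * v\<^sup>2 \<ge> 2 * v\<^sup>2" by (rule mult_right_mono) simp
    then have "2 / eps * (al * v\<^sup>2) \<ge> 2 * v\<^sup>2" by (simp only: mult.assoc)
    moreover have "(f + f ^ 3) * v\<^sup>2 \<ge> 0" using f by simp
    ultimately show ?thesis using young1 zero_le_power2[of g] by linarith
  qed
  have dv: "jac11 M x + jac22 M x = f + f ^ 3"
    by (simp add: div_multiplier[OF M(1)] f_def)
  show ?thesis
    unfolding M_def[symmetric] dv g_def[symmetric] using main g by simp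
qed

lemma multiplier_flux_bound:
  fixes A p q :: real
  assumes "M > 0"
  shows "\<bar>A * (x $ 1 * phi M x * p + x $ 2 * phi M x * q)\<bar> \<le> M * ((A\<^sup>2 + p\<^sup>2 + q\<^sup>2) / 2)"
proof -
  define g where "g = x $ 1 * phi M x * p + x $ 2 * phi M x * q"
  have g: "g\<^sup>2 \<le> M\<^sup>2 * (p\<^sup>2 + q\<^sup>2)"
    using multiplier_norm_sq_le[OF assms, of x p q] by (simp add: g_def)
  have "0 \<le> (M * \<bar>A\<bar> - \<bar>g\<bar>)\<^sup>2" by simp
  then have "2 * M * (\<bar>A\<bar> * \<bar>g\<bar>) \<le> M\<^sup>2 * A\<^sup>2 + g\<^sup>2"
    by (simp add: power2_diff power_mult_distrib algebra_simps)
  also have "\<dots> \<le> M * (M * (A\<^sup>2 + p\<^sup>2 + q\<^sup>2))"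
    using g by (simp add: algebra_simps power2_eq_square)
  finally have "M * (2 * (\<bar>A\<bar> * \<bar>g\<bar>)) \<le> M * (M * (A\<^sup>2 + p\<^sup>2 + q\<^sup>2))" by simp
  then have "2 * (\<bar>A\<bar> * \<bar>g\<bar>) \<le> M * (A\<^sup>2 + p\<^sup>2 + q\<^sup>2)"
    using assms by (simp only: mult_le_cancel_left_pos)
  then show ?thesis unfolding g_def[symmetric] by (simp add: abs_mult)
qed

subsection \<open>The time integral of the solution\<close>

text \<open>Starting at time \<open>1\<close> keeps the interval inside \<open>t > 0\<close>, where
  the equation and all derivative relations are available.\<close>

definition time_integral :: "(real \<Rightarrow> 'a \<Rightarrow> real) \<Rightarrow> real \<Rightarrow> 'a \<Rightarrow> real" where
  "time_integral f t x = integral {1..t} (\<lambda>s. f s x)"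

lemma continuous_slice: "cont_st f \<Longrightarrow> S \<subseteq> {0..} \<Longrightarrow> continuous_on S (\<lambda>s. f s x)"
  by (rule cont_stD) (auto intro!: continuous_intros)

lemma continuous_on_time_integral:
  assumes "cont_st f"
  shows "continuous_on ({1..} \<times> UNIV) (\<lambda>z. time_integral f (fst z) (snd z))"
proof -
  \<comment> \<open>rescaling to the fixed interval \<open>[0, 1]\<close> makes the dependence on \<open>t\<close> a parameter dependence\<close>
  have eq: "time_integral f t x = integral (cbox 0 1) (\<lambda>r. (t - 1) * f (1 + r * (t - 1)) x)" if "t \<ge> 1" for t x
  proof -
    have "((\<lambda>r. (t - 1) *\<^sub>R f (1 + r * (t - 1)) x) has_integral
        integral {1 + 0 * (t - 1)..1 + 1 * (t - 1)} (\<lambda>s. f s x)) {0..1}"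
    proof (rule has_integral_substitution[where c = 1 and d = t and g = "\<lambda>r. 1 + r * (t - 1)"])
      show "(\<lambda>r. 1 + r * (t - 1)) ` {0..1} \<subseteq> {1..t}"
      proof clarsimp
        fix r :: real assume "0 \<le> r" "r \<le> 1"
        then show "0 \<le> r * (t - 1) \<and> 1 + r * (t - 1) \<le> t"
          using that mult_right_mono[of r 1 "t - 1"] by simp
      qed
      show "continuous_on {1..t} (\<lambda>s. f s x)" by (rule continuous_slice[OF assms]) auto
    qed (use that in \<open>auto intro!: derivative_eq_intros\<close>)
    then show ?thesis by (simp add: time_integral_def has_integral_iff)
  qed
  have "continuous_on ({1..} \<times> UNIV) (\<lambda>z. integral (cbox 0 1) (\<lambda>r. (fst z - 1) * f (1 + r * (fst z - 1)) (snd z)))"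
    by (rule integral_continuous_on_param)
      (auto simp: split_beta intro!: continuous_intros cont_stD[OF assms])
  then show ?thesis
    by (subst continuous_on_cong[OF refl eq]) auto
qed

lemma continuous_time_integral_comp:
  "cont_st f \<Longrightarrow> continuous_on S g \<Longrightarrow> continuous_on S h \<Longrightarrow> (\<And>z. z \<in> S \<Longrightarrow> g z \<ge> 1) \<Longrightarrow>
    continuous_on S (\<lambda>z. time_integral f (g z) (h z))"
  by (rule continuous_on_compose2[where f = "\<lambda>z. (g z, h z)", of "{1..} \<times> UNIV"
        "\<lambda>z. time_integral f (fst z) (snd z)", simplified])
    (auto intro!: continuous_intros continuous_on_time_integral)

lemma DERIV_time_integral:
  assumes "cont_st f" "t > 1"
  shows "((\<lambda>s. time_integral f s x) has_real_derivative f t x) (at t)"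
proof -
  have "((\<lambda>s. integral {1..s} (\<lambda>s. f s x)) has_real_derivative f t x) (at t within {1..t+1})"
    by (rule integral_has_real_derivative) (use assms continuous_slice[OF assms(1)] in auto)
  then have "((\<lambda>s. integral {1..s} (\<lambda>s. f s x)) has_real_derivative f t x) (at t within {1<..<t+1})"
    by (rule DERIV_subset) auto
  then show ?thesis
    using assms(2) by (simp add: time_integral_def at_within_open[of t "{1<..<t+1}"])
qed

lemma dir_deriv_time_integral:
  assumes f: "cont_st f" and f': "cont_st f'" and d: "dir_deriv_pos e f f'" and t: "t \<ge> 1"
  shows "dir_deriv e (time_integral f t) (time_integral f' t)"
  unfolding dir_deriv_def
proof
  fix x
  have "((\<lambda>h. integral (cbox 1 t) (\<lambda>s. f s (x + h *\<^sub>R e))) has_real_derivative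
      integral (cbox 1 t) (\<lambda>s. f' s (x + 0 *\<^sub>R e))) (at 0 within UNIV)"
  proof (rule leibniz_rule_field_derivative)
    show "((\<lambda>h. f s (x + h *\<^sub>R e)) has_real_derivative f' s (x + h *\<^sub>R e)) (at h within UNIV)"
      if "s \<in> cbox 1 t" for h s
      using d that by (auto intro!: dir_deriv_line simp: dir_deriv_pos_def)
    show "(\<lambda>s. f s (x + h *\<^sub>R e)) integrable_on cbox 1 t" for h
      by (rule integrable_continuous, rule continuous_slice[OF f]) auto
    show "continuous_on (UNIV \<times> cbox 1 t) (\<lambda>(h, s). f' s (x + h *\<^sub>R e))"
      unfolding split_beta by (rule cont_stD[OF f']) (auto intro!: continuous_intros)
  qed auto
  then show "((\<lambda>h. time_integral f t (x + h *\<^sub>R e)) has_real_derivative time_integral f' t x) (at 0)"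
    by (simp add: time_integral_def)
qed

text \<open>The factor of \<open>1 / (8 * Lam)\<close> is \<open>div (v\<^sup>2 k)\<close> for the field \<open>k x = (T / (1 + |x|\<^sup>2)) x\<close> and
  \<open>(w1, w2) = grad v\<close>, so it integrates to zero. The logarithm in \<open>T\<close> yields
  \<open>|k|\<^sup>2 \<le> 2 * Lam * div k\<close>, a Hardy inequality that loses only a logarithm.\<close>

lemma log_hardy_pointwise:
  fixes v w1 w2 f x1 x2 Lam :: real
  defines "s \<equiv> x1\<^sup>2 + x2\<^sup>2"
  defines "T \<equiv> 1 + ln (1 + s) / Lam"
  assumes Lam: "Lam > 0" and s: "ln (1 + s) \<le> Lam"
  shows "(w1\<^sup>2 + w2\<^sup>2) / 2 - f * v + 1 / (8 * Lam) * ((2 * T / (1 + s)\<^sup>2 + 2 * s / (Lam * (1 + s)\<^sup>2)) * v\<^sup>2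
      + 2 * v * (x1 * (T / (1 + s)) * w1 + x2 * (T / (1 + s)) * w2))
    \<ge> - (2 * Lam * (f\<^sup>2 * (1 + s)\<^sup>2))"
proof -
  have s0: "s \<ge> 0" by (simp add: s_def)
  have T: "1 \<le> T" "T \<le> 2" using s0 s Lam by (auto simp: T_def)
  define q where "q = 1 + s"
  have q: "q > 0" using s0 by (simp add: q_def)
  define D where "D = 2 * T / q\<^sup>2 + 2 * s / (Lam * q\<^sup>2)"
  define kw where "kw = x1 * (T / q) * w1 + x2 * (T / q) * w2"
  have D1: "D \<ge> 2 / q\<^sup>2"
  proof -
    have "2 / q\<^sup>2 \<le> 2 * T / q\<^sup>2" using T by (intro divide_right_mono) auto
    moreover have "2 * s / (Lam * q\<^sup>2) \<ge> 0" using s0 Lam by simp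
    ultimately show ?thesis by (simp add: D_def)
  qed
  \<comment> \<open>The logarithmic part of \<open>D\<close> alone suffices, with
    \<open>T \<le> 2\<close>.\<close>
  have k2: "kw\<^sup>2 \<le> (2 * Lam * D) * (w1\<^sup>2 + w2\<^sup>2)"
  proof -
    have "kw\<^sup>2 = (T / q)\<^sup>2 * (x1 * w1 + x2 * w2)\<^sup>2"
      by (simp add: kw_def power2_eq_square algebra_simps)
    also have "\<dots> \<le> (T / q)\<^sup>2 * (s * (w1\<^sup>2 + w2\<^sup>2))"
      using zero_le_power2[of "x1 * w2 - x2 * w1"]
      by (intro mult_left_mono) (simp_all add: s_def algebra_simps power2_eq_square)
    also have "\<dots> = ((T / q)\<^sup>2 * s) * (w1\<^sup>2 + w2\<^sup>2)" by simp
    also have "\<dots> \<le> (2 * Lam * D) * (w1\<^sup>2 + w2\<^sup>2)"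
    proof (rule mult_right_mono)
      have "(T / q)\<^sup>2 * s = T\<^sup>2 * s / q\<^sup>2" by (simp add: power_divide)
      also have "\<dots> \<le> 4 * s / q\<^sup>2"
        using T s0 power_mono[of T 2 2] by (intro divide_right_mono mult_right_mono) auto
      also have "4 * s / q\<^sup>2 = 2 * Lam * (2 * s / (Lam * q\<^sup>2))"
        using Lam q by (simp add: field_simps)
      also have "\<dots> \<le> 2 * Lam * D"
        using T Lam q by (intro mult_left_mono) (auto simp: D_def)
      finally show "(T / q)\<^sup>2 * s \<le> 2 * Lam * D" .
    qed simp
    finally show ?thesis .
  qed
  have Dpos: "D > 0" using D1 q by (smt (verit) divide_pos_pos zero_less_power)
  \<comment> \<open>Half of \<open>D v^2 / (8 Lam)\<close> and the whole gradient term absorb the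
    cross term; \<open>1 / (8 Lam)\<close> is the largest factor for which this works. The other
    half is kept for the source.\<close>
  have cross: "v * kw / (4 * Lam) \<ge> - ((w1\<^sup>2 + w2\<^sup>2) / 2) - D * v\<^sup>2 / (16 * Lam)"
  proof -
    have "0 \<le> (D * v + 2 * kw)\<^sup>2" by simp
    then have "4 * D * (v * kw) \<ge> - (D\<^sup>2 * v\<^sup>2) - 4 * kw\<^sup>2"
      by (simp add: power2_eq_square algebra_simps)
    moreover have "4 * kw\<^sup>2 \<le> 4 * (2 * Lam * D * (w1\<^sup>2 + w2\<^sup>2))" using k2 by (rule mult_left_mono) simp
    ultimately have "D * (- (D * v\<^sup>2) - 8 * Lam * (w1\<^sup>2 + w2\<^sup>2)) \<le> D * (4 * (v * kw))"
      by (simp add: power2_eq_square algebra_simps)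
    then have "- (D * v\<^sup>2) - 8 * Lam * (w1\<^sup>2 + w2\<^sup>2) \<le> 4 * (v * kw)"
      using Dpos by simp
    then have "(- (D * v\<^sup>2) - 8 * Lam * (w1\<^sup>2 + w2\<^sup>2)) / (16 * Lam) \<le> 4 * (v * kw) / (16 * Lam)"
      using Lam by (intro divide_right_mono) auto
    moreover have "(- (D * v\<^sup>2) - 8 * Lam * (w1\<^sup>2 + w2\<^sup>2)) / (16 * Lam) = - ((w1\<^sup>2 + w2\<^sup>2) / 2) - D * v\<^sup>2 / (16 * Lam)"
      "4 * (v * kw) / (16 * Lam) = v * kw / (4 * Lam)"
      using Lam by (simp_all add: field_simps)
    ultimately show ?thesis by linarith
  qed
  have source: "D * v\<^sup>2 / (16 * Lam) - f * v \<ge> - (2 * Lam * (f\<^sup>2 * q\<^sup>2))"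
  proof -
    have "2 / q\<^sup>2 * v\<^sup>2 / (16 * Lam) \<le> D * v\<^sup>2 / (16 * Lam)"
      using D1 Lam by (intro divide_right_mono mult_right_mono) auto
    moreover have "0 \<le> (v - 4 * Lam * q\<^sup>2 * f)\<^sup>2 / (8 * Lam * q\<^sup>2)" using Lam by simp
    moreover have "(v - 4 * Lam * q\<^sup>2 * f)\<^sup>2 / (8 * Lam * q\<^sup>2)
        = 2 / q\<^sup>2 * v\<^sup>2 / (16 * Lam) - f * v + 2 * Lam * (f\<^sup>2 * q\<^sup>2)"
      using Lam q by (simp add: field_simps power2_eq_square)
    ultimately show ?thesis by linarith
  qed
  have "1 / (8 * Lam) * (D * v\<^sup>2 + 2 * v * kw) = D * v\<^sup>2 / (16 * Lam) + D * v\<^sup>2 / (16 * Lam) + v * kw / (4 * Lam)"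
    using Lam by (simp add: field_simps)
  then show ?thesis
    using cross source unfolding D_def[symmetric] kw_def[symmetric] q_def[symmetric] by linarith
qed

context damped_wave begin

text \<open>The time integral \<open>v\<close> of the solution from time \<open>1\<close> satisfies
  \<open>v\<^sub>t\<^sub>t - laplacian v + a * v\<^sub>t = potential_data\<close>.\<close>

definition potential_data :: "real^2 \<Rightarrow> real" where
  "potential_data x = ut 1 x + a x * u 1 x"

text \<open>The wave equation integrated over \<open>[1, t]\<close>; the boundary terms at time
  \<open>1\<close> form \<open>potential_data\<close>.\<close>

lemma time_integral_wave_eq:
  assumes t: "t > 1"
  shows "ut t x = time_integral uxx t x + time_integral uyy t x - a x * u t x + potential_data x"
proof -
  have FTC: "(f' has_integral f t - f 1) {1..t}"
    if "\<And>s. s > 0 \<Longrightarrow> (f has_real_derivative f' s) (at s)" for f f' :: "real \<Rightarrow> real"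
    using t that by (intro fundamental_theorem_of_calculus)
      (auto simp: has_real_derivative_iff_has_vector_derivative[symmetric] intro: has_field_derivative_at_within)
  have "((\<lambda>s. utt s x) has_integral ut t x - ut 1 x) {1..t}" by (rule FTC) (rule DERIV_t)
  moreover have "((\<lambda>s. uxx s x + uyy s x - a x * ut s x) has_integral
      time_integral uxx t x + time_integral uyy t x - a x * (u t x - u 1 x)) {1..t}"
    unfolding time_integral_def
    by (intro has_integral_diff has_integral_add has_integral_mult_right integrable_integral
        integrable_continuous_real continuous_slice cont FTC DERIV_t) auto
  then have "((\<lambda>s. utt s x) has_integral
      time_integral uxx t x + time_integral uyy t x - a x * (u t x - u 1 x)) {1..t}"
    by (rule has_integral_eq[rotated]) (simp add: wave_eq)
  ultimately have "ut t x - ut 1 x = time_integral uxx t x + time_integral uyy t x - a x * (u t x - u 1 x)"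
    by (rule has_integral_unique)
  then show ?thesis by (simp add: potential_data_def algebra_simps)
qed

lemma time_integral_vanishing:
  assumes "t \<ge> 1" "norm x > R + t"
  shows "time_integral u t x = 0" "time_integral ux t x = 0" "time_integral uy t x = 0"
proof -
  have "integral {1..t} (\<lambda>s. f s x) = 0" if "\<And>s. s \<in> {1..t} \<Longrightarrow> f s x = 0" for f :: "real \<Rightarrow> real^2 \<Rightarrow> real"
    using that by (subst integral_cong[where g = "\<lambda>_. 0"]) auto
  then show "time_integral u t x = 0" "time_integral ux t x = 0" "time_integral uy t x = 0"
    using assms unfolding time_integral_def by (auto simp: finite_propagation)
qed

text \<open>Energy of the time integral \<open>v\<close>, whose time derivative is \<open>u\<close>.
  The source does not depend on time, so its work can be stored in the functional as
  \<open>- potential_data * v\<close>.\<close>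

definition potential_int :: "real \<Rightarrow> real" where
  "potential_int t = (LINT x|lborel. (u t x)\<^sup>2 / 2
      + ((time_integral ux t x)\<^sup>2 + (time_integral uy t x)\<^sup>2) / 2 - potential_data x * time_integral u t x)"

lemmas time_integral_intros [continuous_intros] = cont[THEN continuous_time_integral_comp]

lemma continuous_potential_data: "continuous_on A potential_data"
  unfolding potential_data_def[abs_def] by (auto intro!: continuous_intros)

text \<open>Multiplier \<open>v_t = u\<close>, so the dissipation \<open>a v_t^2\<close> is the
  damped mass; the flux is \<open>u grad v\<close>.\<close>

lemma potential_deriv:
  assumes t: "t > 1"
  shows "(potential_int has_real_derivative - damped_mass_int t) (at t)"
proof -
  note [continuous_intros] = continuous_on_compose2[OF continuous_potential_data _ subset_UNIV]
  have Dx: "((\<lambda>h. time_integral ux t (x + h *\<^sub>R e1)) has_real_derivative time_integral uxx t x) (at 0)"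
    "((\<lambda>h. time_integral uy t (x + h *\<^sub>R e2)) has_real_derivative time_integral uyy t x) (at 0)" for x
    using dir_deriv_time_integral[OF cont(4,8) dx_pos(3), of t] dir_deriv_time_integral[OF cont(5,10) dy_pos(4), of t] t
    by (auto simp: dir_deriv_def)
  have "((\<lambda>t. LINT x|lborel. (u t x)\<^sup>2 / 2
      + ((time_integral ux t x)\<^sup>2 + (time_integral uy t x)\<^sup>2) / 2 - potential_data x * time_integral u t x)
      has_real_derivative (LINT x|lborel. - (a x * (u t x)\<^sup>2))) (at t)"
  proof (rule balance_law[where T = "{1<..<t+1}" and r = "R + t + 1" and
      P' = "\<lambda>t x. u t x * ut t x + (time_integral ux t x * ux t x + time_integral uy t x * uy t x)
        - potential_data x * u t x" and ?e1.0 = e1 and ?e2.0 = e2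
      and ?F1.0 = "\<lambda>x. u t x * time_integral ux t x" and ?F2.0 = "\<lambda>x. u t x * time_integral uy t x"
      and ?D1.0 = "\<lambda>x. ux t x * time_integral ux t x + u t x * time_integral uxx t x"
      and ?D2.0 = "\<lambda>x. uy t x * time_integral uy t x + u t x * time_integral uyy t x"])
    show "((\<lambda>s. (u s x)\<^sup>2 / 2 + ((time_integral ux s x)\<^sup>2 + (time_integral uy s x)\<^sup>2) / 2
        - potential_data x * time_integral u s x) has_real_derivative
        u s x * ut s x + (time_integral ux s x * ux s x + time_integral uy s x * uy s x)
        - potential_data x * u s x) (at s)" if "s \<in> {1<..<t+1}" for s x
      using that by (auto intro!: derivative_eq_intros DERIV_t DERIV_time_integral cont)
    show "u t x * ut t x + (time_integral ux t x * ux t x + time_integral uy t x * uy t x)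
        - potential_data x * u t x = (ux t x * time_integral ux t x + u t x * time_integral uxx t x)
        + (uy t x * time_integral uy t x + u t x * time_integral uyy t x) + - (a x * (u t x)\<^sup>2)" for x
      by (simp add: time_integral_wave_eq[OF t] algebra_simps power2_eq_square)
    show "dir_deriv e1 (\<lambda>x. u t x * time_integral ux t x)
        (\<lambda>x. ux t x * time_integral ux t x + u t x * time_integral uxx t x)"
      "dir_deriv e2 (\<lambda>x. u t x * time_integral uy t x)
        (\<lambda>x. uy t x * time_integral uy t x + u t x * time_integral uyy t x)"
      using t by (auto simp: dir_deriv_def intro!: derivative_eq_intros DERIV_x DERIV_y Dx)
  qed (use t in \<open>auto intro!: continuous_intros simp: finite_propagation time_integral_vanishing\<close>)
  then show ?thesis by (simp add: potential_int_def[abs_def] damped_mass_int_def)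
qed

text \<open>\<open>Lam\<close> bounds \<open>ln (1 + |x|^2)\<close> on the support at time
  \<open>t\<close>, as \<open>log_hardy_pointwise\<close> requires. The weighted integral of the
  source is independent of \<open>t\<close>, so only the logarithm grows.\<close>

lemma potential_lower_bound:
  assumes t: "t > 1"
  shows "potential_int t \<ge> - (2 * ln (1 + (R + t)\<^sup>2) * (LINT x|lborel. (potential_data x)\<^sup>2 * (1 + ((x $ 1)\<^sup>2 + (x $ 2)\<^sup>2))\<^sup>2))"
proof -
  note [continuous_intros] = continuous_on_compose2[OF continuous_potential_data _ subset_UNIV]
  define Lam where "Lam = ln (1 + (R + t)\<^sup>2)"
  have "(R + t)\<^sup>2 > 0" using R_pos t by simp
  then have "1 < 1 + (R + t)\<^sup>2" by linarith
  then have Lam: "Lam > 0" unfolding Lam_def by (rule ln_gt_zero)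
  define s where "s = (\<lambda>x::real^2. (x $ 1)\<^sup>2 + (x $ 2)\<^sup>2)"
  have s0: "s x \<ge> 0" for x by (simp add: s_def)
  have s1: "1 + s x > 0" for x using s0[of x] by linarith
  define T where "T = (\<lambda>x. 1 + ln (1 + s x) / Lam)"
  define m where "m = (\<lambda>x. T x / (1 + s x))"
  \<comment> \<open>Chosen so that the gradient of the radial factor \<open>m\<close> is
    \<open>m'\<close> times \<open>x\<close>.\<close>
  define m' where "m' = (\<lambda>x. 2 * (1 / (Lam * (1 + s x)\<^sup>2) - T x / (1 + s x)\<^sup>2))"
  let ?v = "time_integral u t" and ?w1 = "time_integral ux t" and ?w2 = "time_integral uy t"
  have cs: "continuous_on A s" for A unfolding s_def by (intro continuous_intros)
  have cT: "continuous_on A T" for A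
    unfolding T_def using Lam s1 by (auto intro!: continuous_intros cs simp: less_imp_neq[symmetric])
  have cm: "continuous_on A m" "continuous_on A m'" for A
    unfolding m_def m'_def using Lam s1 by (auto intro!: continuous_intros cs cT simp: less_imp_neq[symmetric])
  have alg: "((1 / (1 + s x) * (2 * y)) / Lam * (1 + s x) - T x * (2 * y)) / ((1 + s x) * (1 + s x)) = y * m' x" for x y
  proof -
    have "((1 / q * (2 * y)) / Lam * q - \<tau> * (2 * y)) / (q * q) = y * (2 * (1 / (Lam * q\<^sup>2) - \<tau> / q\<^sup>2))"
      if "q > 0" for q \<tau> :: real
      using that Lam by (simp add: divide_simps power2_eq_square) (simp add: algebra_simps)
    from this[OF s1] show ?thesis by (simp add: m'_def)
  qed
  have sx: "((\<lambda>h. s (x + h *\<^sub>R e1)) has_real_derivative 2 * x $ 1) (at 0)"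
    "((\<lambda>h. s (x + h *\<^sub>R e2)) has_real_derivative 2 * x $ 2) (at 0)" for x
    unfolding s_def coord_line by (auto intro!: derivative_eq_intros)
  have sx1: "((\<lambda>h. 1 + s (x + h *\<^sub>R e1)) has_real_derivative 2 * x $ 1) (at 0)"
    "((\<lambda>h. 1 + s (x + h *\<^sub>R e2)) has_real_derivative 2 * x $ 2) (at 0)" for x
    by (auto intro!: derivative_eq_intros sx)
  have Tx: "((\<lambda>h. T (x + h *\<^sub>R e1)) has_real_derivative (1 / (1 + s x) * (2 * x $ 1)) / Lam) (at 0)"
    "((\<lambda>h. T (x + h *\<^sub>R e2)) has_real_derivative (1 / (1 + s x) * (2 * x $ 2)) / Lam) (at 0)" for x
    unfolding T_def using s1[of x] Lam by (auto intro!: derivative_eq_intros sx)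
  have mx: "((\<lambda>h. m (x + h *\<^sub>R e1)) has_real_derivative x $ 1 * m' x) (at 0)" for x
    unfolding m_def
    by (rule DERIV_cong, rule DERIV_divide[OF Tx(1) sx1(1)]) (use s1[of x] alg[of x "x $ 1"] in auto)
  have my: "((\<lambda>h. m (x + h *\<^sub>R e2)) has_real_derivative x $ 2 * m' x) (at 0)" for x
    unfolding m_def
    by (rule DERIV_cong, rule DERIV_divide[OF Tx(2) sx1(2)]) (use s1[of x] alg[of x "x $ 2"] in auto)
  have vx: "((\<lambda>h. ?v (x + h *\<^sub>R e1)) has_real_derivative ?w1 x) (at 0)"
    "((\<lambda>h. ?v (x + h *\<^sub>R e2)) has_real_derivative ?w2 x) (at 0)" for x
    using dir_deriv_time_integral[OF cont(1,4) dx_pos(1), of t] dir_deriv_time_integral[OF cont(1,5) dy_pos(1), of t] t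
    by (auto simp: dir_deriv_def)
  let ?D1 = "\<lambda>x. (m x + x $ 1 * (x $ 1 * m' x)) * (?v x)\<^sup>2 + 2 * ?v x * (x $ 1 * m x * ?w1 x)"
  let ?D2 = "\<lambda>x. (m x + x $ 2 * (x $ 2 * m' x)) * (?v x)\<^sup>2 + 2 * ?v x * (x $ 2 * m x * ?w2 x)"
  have I1: "(LINT x|lborel. ?D1 x) = 0"
    by (rule integral_dir_deriv_eq_0[of e1 "\<lambda>x. x $ 1 * m x * (?v x)\<^sup>2" _ "R + t"])
      (use t in \<open>auto intro!: continuous_intros cm derivative_eq_intros mx vx
        simp: dir_deriv_def time_integral_vanishing algebra_simps\<close>)
  have I2: "(LINT x|lborel. ?D2 x) = 0"
    by (rule integral_dir_deriv_eq_0[of e2 "\<lambda>x. x $ 2 * m x * (?v x)\<^sup>2" _ "R + t"])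
      (use t in \<open>auto intro!: continuous_intros cm derivative_eq_intros my vx
        simp: dir_deriv_def time_integral_vanishing algebra_simps\<close>)
  have div: "(m x + x $ 1 * (x $ 1 * m' x)) + (m x + x $ 2 * (x $ 2 * m' x))
      = 2 * T x / (1 + s x)\<^sup>2 + 2 * s x / (Lam * (1 + s x)\<^sup>2)" for x
  proof -
    have "(m x + x $ 1 * (x $ 1 * m' x)) + (m x + x $ 2 * (x $ 2 * m' x)) = 2 * m x + s x * m' x"
      by (simp add: s_def algebra_simps power2_eq_square)
    also have "\<dots> = 2 * T x / (1 + s x)\<^sup>2 + 2 * s x / (Lam * (1 + s x)\<^sup>2)"
    proof -
      have "2 * (\<tau> / q) + (q - 1) * (2 * (1 / (Lam * q\<^sup>2) - \<tau> / q\<^sup>2)) = 2 * \<tau> / q\<^sup>2 + 2 * (q - 1) / (Lam * q\<^sup>2)"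
        if "q > 0" for q \<tau> :: real
        using that Lam by (simp add: divide_simps power2_eq_square) (simp add: algebra_simps)
      from this[OF s1[of x], of "T x"] show ?thesis by (simp add: m_def m'_def)
    qed
    finally show ?thesis .
  qed
  let ?f = potential_data
  let ?W = "\<lambda>x. ((?w1 x)\<^sup>2 + (?w2 x)\<^sup>2) / 2 - ?f x * ?v x"
  have fv: "?f x = 0" if "norm x > R + t" for x
    using that t finite_propagation[of 1 x] by (simp add: potential_data_def)
  have point: "- (2 * Lam * ((?f x)\<^sup>2 * (1 + s x)\<^sup>2)) \<le> ?W x + 1 / (8 * Lam) * (?D1 x + ?D2 x)" for x
  proof (cases "norm x > R + t")
    case False
    have "s x \<le> (R + t)\<^sup>2"
      using False power_mono[of "norm x" "R + t" 2] by (simp add: s_def norm_eq_coords[symmetric])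
    then have "ln (1 + s x) \<le> Lam"
      unfolding Lam_def using s1[of x] by (subst ln_le_cancel_iff) (auto simp: add_pos_nonneg)
    moreover have seq: "(x $ 1)\<^sup>2 + (x $ 2)\<^sup>2 = s x" by (simp add: s_def)
    ultimately have "- (2 * Lam * ((?f x)\<^sup>2 * (1 + s x)\<^sup>2)) \<le> ?W x + 1 / (8 * Lam) *
      ((2 * T x / (1 + s x)\<^sup>2 + 2 * s x / (Lam * (1 + s x)\<^sup>2)) * (?v x)\<^sup>2
      + 2 * ?v x * (x $ 1 * m x * ?w1 x + x $ 2 * m x * ?w2 x))"
      using log_hardy_pointwise[where ?x1.0 = "x $ 1" and ?x2.0 = "x $ 2" and Lam = Lam and f = "?f x"
          and v = "?v x" and ?w1.0 = "?w1 x" and ?w2.0 = "?w2 x", unfolded seq, OF Lam]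
      unfolding T_def m_def by blast
    also have "\<dots> = ?W x + 1 / (8 * Lam) * (?D1 x + ?D2 x)"
      unfolding div[symmetric] by (simp add: algebra_simps)
    finally show ?thesis .
  qed (use t in \<open>simp add: time_integral_vanishing fv\<close>)
  have int: "integrable lborel ?W" "integrable lborel (\<lambda>x. (u t x)\<^sup>2 / 2)" "integrable lborel ?D1"
    "integrable lborel ?D2" "integrable lborel (\<lambda>x. (?f x)\<^sup>2 * (1 + s x)\<^sup>2)"
    using t by (auto intro!: continuous_vanishing_integrable[of _ "R + t"] continuous_intros cm cs
        simp: time_integral_vanishing finite_propagation fv)
  have "- (2 * Lam * (LINT x|lborel. (?f x)\<^sup>2 * (1 + s x)\<^sup>2)) = (LINT x|lborel. - (2 * Lam * ((?f x)\<^sup>2 * (1 + s x)\<^sup>2)))"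
    by simp
  also have "\<dots> \<le> (LINT x|lborel. ?W x + 1 / (8 * Lam) * (?D1 x + ?D2 x))"
    using int point by (intro integral_mono) auto
  also have "\<dots> = (LINT x|lborel. ?W x)"
    using int I1 I2 by simp
  also have "\<dots> \<le> (LINT x|lborel. (u t x)\<^sup>2 / 2 + ?W x)"
    using int by (intro integral_mono) auto
  also have "\<dots> = potential_int t" by (simp add: potential_int_def add_diff_eq)
  finally show ?thesis by (simp add: Lam_def s_def)
qed

end

subsection \<open>Decay\<close>

text \<open>\<open>1 + (R + t)^2 \<le> 5 t^2 \<le> t^5\<close>, since \<open>5 \<le> t^3\<close> for
  \<open>t \<ge> 2\<close>.\<close>

lemma ln_shifted_square_le:
  assumes "R \<ge> 0" "t \<ge> 2" "t \<ge> R"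
  shows "ln (1 + (R + t)\<^sup>2) \<le> 5 * ln (t::real)"
proof -
  have "(R + t)\<^sup>2 \<le> (2 * t)\<^sup>2" using assms by (intro power_mono) auto
  moreover have "1 \<le> t\<^sup>2" using assms by (simp add: one_le_power)
  ultimately have "1 + (R + t)\<^sup>2 \<le> 5 * t\<^sup>2" by (simp add: power_mult_distrib)
  also have "5 \<le> t ^ 3" using assms power_mono[of 2 t 3] by simp
  then have "5 * t\<^sup>2 \<le> t ^ 3 * t\<^sup>2" by (rule mult_right_mono) simp
  also have "\<dots> = t ^ 5" by (simp flip: power_add)
  finally have "ln (1 + (R + t)\<^sup>2) \<le> ln (t ^ 5)"
    using assms by (subst ln_le_cancel_iff) (auto simp: add_pos_nonneg)
  also have "\<dots> = 5 * ln t" using assms by (simp add: ln_realpow)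
  finally show ?thesis .
qed

section \<open>Lyapunov functionals and decay for damping that is effective outside a ball\<close>

locale effectively_damped_wave = damped_wave +
  fixes L eps B :: real
  assumes L_pos: "L > 0" and eps_pos: "eps > 0" and a_le: "\<And>x. a x \<le> B"
    and a_ge: "\<And>x. norm x > L \<longrightarrow> a x \<ge> eps"
begin

text \<open>\<open>18 * B * L\<^sup>2 + 1 / eps\<close> is what coercivity demands; the remaining
  terms let the energy dominate the two indefinite multiplier integrals in
  \<open>lyapunov_bounds\<close> with one full \<open>energy_int\<close> to spare.\<close>

definition gain :: real where
  "gain = 18 * B * L\<^sup>2 + 4 / eps + 3 * L + 4 * eps * L\<^sup>2 + 1"

definition hx :: "real^2 \<Rightarrow> real" where "hx x = x $ 1 * phi (3 * L) x"
definition hy :: "real^2 \<Rightarrow> real" where "hy x = x $ 2 * phi (3 * L) x"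

definition lyapunov :: "real \<Rightarrow> real" where
  "lyapunov t = (LINT x|lborel. ut t x * (hx x * ux t x + hy x * uy t x))
    + 3 / 4 * (LINT x|lborel. ut t x * u t x + a x * (u t x)\<^sup>2 / 2) + gain * energy_int t"

lemma B_nonneg: "B \<ge> 0"
  using a_nonneg[of 0] a_le[of 0] by linarith

lemma multiplier_cont:
  "continuous_on UNIV hx" "continuous_on UNIV hy" "continuous_on UNIV (jac11 (3 * L))"
  "continuous_on UNIV (jac12 (3 * L))" "continuous_on UNIV (jac22 (3 * L))"
  using continuous_multiplier[of "3 * L"] L_pos by (simp_all add: hx_def[abs_def] hy_def[abs_def])

lemmas multiplier_cont_intros [continuous_intros] = multiplier_cont[THEN continuous_on_compose2, OF _ subset_UNIV]

lemma multiplier_dir_deriv: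
  "dir_deriv e1 hx (jac11 (3 * L))" "dir_deriv e2 hx (jac12 (3 * L))"
  "dir_deriv e1 hy (jac12 (3 * L))" "dir_deriv e2 hy (jac22 (3 * L))"
  using dir_deriv_multiplier[of "3 * L"] L_pos by (simp_all add: hx_def[abs_def] hy_def[abs_def])

lemma integrable_terms:
  assumes "t > 0"
  shows "integrable lborel (energy_dens t)"
    "integrable lborel (\<lambda>x. (u t x)\<^sup>2)" "integrable lborel (\<lambda>x. a x * (u t x)\<^sup>2)"
    "integrable lborel (\<lambda>x. a x * (ut t x)\<^sup>2)" "integrable lborel (\<lambda>x. ut t x * u t x)"
    "integrable lborel (\<lambda>x. ut t x * (hx x * ux t x + hy x * uy t x))"
    "integrable lborel (\<lambda>x. (jac11 (3 * L) x + jac22 (3 * L) x) * (u t x)\<^sup>2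
      + 2 * u t x * (hx x * ux t x + hy x * uy t x))"
    "integrable lborel (\<lambda>x. (ut t x)\<^sup>2 - (ux t x)\<^sup>2 - (uy t x)\<^sup>2)"
    "integrable lborel (\<lambda>x. a x * ut t x * (hx x * ux t x + hy x * uy t x)
      + (jac11 (3 * L) x + jac22 (3 * L) x) * ((ut t x)\<^sup>2 - (ux t x)\<^sup>2 - (uy t x)\<^sup>2) / 2
      + (jac11 (3 * L) x * (ux t x)\<^sup>2 + 2 * jac12 (3 * L) x * ux t x * uy t x + jac22 (3 * L) x * (uy t x)\<^sup>2))"
  unfolding energy_dens_def[abs_def]
  using assms by (auto intro!: vanishing_integrable[OF assms] continuous_intros)

lemma lyapunov_deriv:
  assumes t: "t > 0"
  obtains G' where "(lyapunov has_real_derivative G') (at t)" "G' \<le> - (1 / 5) * energy_int t"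
proof -
  define X where "X = (\<lambda>x. a x * ut t x * (hx x * ux t x + hy x * uy t x)
      + (jac11 (3 * L) x + jac22 (3 * L) x) * ((ut t x)\<^sup>2 - (ux t x)\<^sup>2 - (uy t x)\<^sup>2) / 2
      + (jac11 (3 * L) x * (ux t x)\<^sup>2 + 2 * jac12 (3 * L) x * ux t x * uy t x + jac22 (3 * L) x * (uy t x)\<^sup>2))"
  define Y where "Y = (\<lambda>x. (ut t x)\<^sup>2 - (ux t x)\<^sup>2 - (uy t x)\<^sup>2)"
  define Z where "Z = (\<lambda>x. a x * (ut t x)\<^sup>2)"
  let ?E = "energy_dens t"
  have int: "integrable lborel ?E" "integrable lborel X" "integrable lborel Y" "integrable lborel Z"
    unfolding X_def Y_def Z_def by (rule integrable_terms[OF t])+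
  have "(lyapunov has_real_derivative - (LINT x|lborel. X x) + 3 / 4 * (LINT x|lborel. Y x)
      + gain * - (LINT x|lborel. Z x)) (at t)"
    unfolding lyapunov_def[abs_def] X_def Y_def Z_def
    by (intro DERIV_add DERIV_cmult energy_deriv mass_multiplier_deriv morawetz_multiplier_deriv
        multiplier_dir_deriv multiplier_cont t)
  moreover have "- (LINT x|lborel. X x) + 3 / 4 * (LINT x|lborel. Y x) + gain * - (LINT x|lborel. Z x)
      \<le> - (1 / 5) * energy_int t"
  proof -
    \<comment> \<open>The pointwise estimate bounds twice the density by \<open>10\<close> times the
      dissipation, hence the rate \<open>1/5\<close>.\<close>
    have "(LINT x|lborel. 2 * ?E x) \<le> (LINT x|lborel. 10 * (X x - 3 / 4 * Y x + gain * Z x))"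
    proof (rule integral_mono)
      fix x
      have gain: "18 * B * L\<^sup>2 + 1 / eps \<le> gain"
        using L_pos eps_pos by (simp add: gain_def divide_right_mono add_increasing2)
      have "2 * ?E x = (ut t x)\<^sup>2 + (ux t x)\<^sup>2 + (uy t x)\<^sup>2" by (simp add: energy_dens_def)
      also have "\<dots> \<le> 10 * (X x - 3 / 4 * Y x + gain * Z x)"
        unfolding X_def Y_def Z_def hx_def hy_def
        by (rule multiplier_coercive[OF L_pos eps_pos a_nonneg[of x] a_le[of x] a_ge[of x] gain])
      finally show "2 * ?E x \<le> 10 * (X x - 3 / 4 * Y x + gain * Z x)" .
    qed (use int in auto)
    then have "2 * energy_int t \<le> 10 * ((LINT x|lborel. X x) - 3 / 4 * (LINT x|lborel. Y x) + gain * (LINT x|lborel. Z x))"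
      using int by (simp add: energy_int_def)
    then show ?thesis by simp
  qed
  ultimately show ?thesis by (rule that)
qed

lemma energy_nonneg: "energy_int t \<ge> 0"
  by (simp add: energy_int_def energy_dens_def)

lemma damped_mass_nonneg: "damped_mass_int t \<ge> 0"
  using a_nonneg by (simp add: damped_mass_int_def)

text \<open>Where \<open>a\<close> may vanish, \<open>damped_mass_int\<close> does not see
  \<open>u^2\<close>. The pointwise bound covers that region by gradient terms, up to a divergence
  \<open>?Q\<close> that integrates to zero.\<close>

lemma mass_le:
  assumes t: "t > 0"
  shows "mass_int t \<le> 36 * L\<^sup>2 * energy_int t + 2 / eps * damped_mass_int t"
proof -
  let ?E = "energy_dens t"
  let ?Q = "\<lambda>x. (jac11 (3 * L) x + jac22 (3 * L) x) * (u t x)\<^sup>2 + 2 * u t x * (hx x * ux t x + hy x * uy t x)"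
  have "(LINT x|lborel. (u t x)\<^sup>2) \<le> (LINT x|lborel. 36 * L\<^sup>2 * ?E x + 2 / eps * (a x * (u t x)\<^sup>2) + ?Q x)"
  proof (rule integral_mono)
    fix x
    have "36 * L\<^sup>2 * (((ux t x)\<^sup>2 + (uy t x)\<^sup>2) / 2) \<le> 36 * L\<^sup>2 * ?E x"
      by (intro mult_left_mono) (auto simp: energy_dens_def)
    then show "(u t x)\<^sup>2 \<le> 36 * L\<^sup>2 * ?E x + 2 / eps * (a x * (u t x)\<^sup>2) + ?Q x"
      using multiplier_mass_bound[OF L_pos eps_pos a_nonneg[of x] a_ge[of x], where v = "u t x" and p = "ux t x" and q = "uy t x"]
      unfolding hx_def hy_def by linarith
  qed (use integrable_terms[OF t] in auto)
  also have "\<dots> = 36 * L\<^sup>2 * energy_int t + 2 / eps * damped_mass_int t + (LINT x|lborel. ?Q x)"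
    using integrable_terms[OF t] by (simp add: energy_int_def damped_mass_int_def)
  also have "(LINT x|lborel. ?Q x) = 0"
    by (rule integral_multiplier_mass_eq_0[OF t multiplier_dir_deriv(1,4) multiplier_cont(1,2,3,5)])
  finally show ?thesis by (simp add: mass_int_def)
qed

lemma lyapunov_bounds:
  assumes t: "t > 0"
  shows "energy_int t + 3 / 16 * damped_mass_int t \<le> lyapunov t"
    and "lyapunov t \<le> damped_mass_int t + 2 * gain * energy_int t"
proof -
  let ?E = "energy_dens t"
  note int = integrable_terms[OF t]
  define M3 where "M3 = (LINT x|lborel. ut t x * (hx x * ux t x + hy x * uy t x))"
  define M1 where "M1 = (LINT x|lborel. ut t x * u t x)"
  have M3: "\<bar>M3\<bar> \<le> 3 * L * energy_int t"
  proof -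
    have "\<bar>M3\<bar> \<le> (LINT x|lborel. \<bar>ut t x * (hx x * ux t x + hy x * uy t x)\<bar>)"
      unfolding M3_def by (rule integral_abs_bound)
    also have "\<dots> \<le> (LINT x|lborel. 3 * L * ?E x)"
    proof (rule integral_mono[OF integrable_abs[OF int(6)] integrable_mult_right[OF int(1)]])
      show "\<bar>ut t x * (hx x * ux t x + hy x * uy t x)\<bar> \<le> 3 * L * ?E x" for x
        using multiplier_flux_bound[of "3 * L" "ut t x" x "ux t x" "uy t x"] L_pos by (simp add: hx_def hy_def energy_dens_def)
    qed
    finally show ?thesis by (simp add: energy_int_def)
  qed
  \<comment> \<open>The weight \<open>eps / 8\<close> turns, through \<open>mass_le\<close>, into
    \<open>1/4\<close> of the damped mass. Multiplied by \<open>3/4\<close> this takes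
    \<open>3/16\<close> of the \<open>3/8\<close> present in \<open>lyapunov\<close> and leaves the
    \<open>3/16\<close> of the lower bound.\<close>
  have M1: "\<bar>M1\<bar> \<le> eps / 8 * mass_int t + 4 / eps * energy_int t"
  proof -
    have "\<bar>M1\<bar> \<le> (LINT x|lborel. \<bar>ut t x * u t x\<bar>)"
      unfolding M1_def by (rule integral_abs_bound)
    also have "\<dots> \<le> (LINT x|lborel. eps / 8 * (u t x)\<^sup>2 + 4 / eps * ?E x)"
    proof (rule integral_mono[OF integrable_abs[OF int(5)]
          Bochner_Integration.integrable_add[OF integrable_mult_right[OF int(2)] integrable_mult_right[OF int(1)]]])
      fix x
      have "0 \<le> (eps * \<bar>u t x\<bar> - 4 * \<bar>ut t x\<bar>)\<^sup>2 / (8 * eps)" using eps_pos by simp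
      also have "\<dots> = eps / 8 * (u t x)\<^sup>2 + 4 / eps * ((ut t x)\<^sup>2 / 2) - \<bar>ut t x * u t x\<bar>"
        using eps_pos by (simp add: power2_diff abs_mult field_simps power2_eq_square)
      finally have "\<bar>ut t x * u t x\<bar> \<le> eps / 8 * (u t x)\<^sup>2 + 4 / eps * ((ut t x)\<^sup>2 / 2)" by simp
      also have "\<dots> \<le> eps / 8 * (u t x)\<^sup>2 + 4 / eps * ?E x"
        using eps_pos by (intro add_left_mono mult_left_mono) (auto simp: energy_dens_def)
      finally show "\<bar>ut t x * u t x\<bar> \<le> eps / 8 * (u t x)\<^sup>2 + 4 / eps * ?E x" .
    qed
    also have "\<dots> = eps / 8 * mass_int t + 4 / eps * energy_int t"
      using int by (simp add: energy_int_def mass_int_def)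
    finally show ?thesis .
  qed
  have "eps / 8 * mass_int t \<le> eps / 8 * (36 * L\<^sup>2 * energy_int t + 2 / eps * damped_mass_int t)"
    using mass_le[OF t] eps_pos by (intro mult_left_mono) auto
  also have "\<dots> = 9 / 2 * eps * L\<^sup>2 * energy_int t + damped_mass_int t / 4"
    using eps_pos by (simp add: field_simps)
  finally have M1': "\<bar>M1\<bar> \<le> (9 / 2 * eps * L\<^sup>2 + 4 / eps) * energy_int t + damped_mass_int t / 4"
    using M1 unfolding distrib_right by linarith
  have G: "lyapunov t = M3 + 3 / 4 * M1 + 3 / 8 * damped_mass_int t + gain * energy_int t"
    using int by (simp add: lyapunov_def M3_def M1_def damped_mass_int_def)
  have K: "(3 * L + 3 / 4 * (9 / 2 * eps * L\<^sup>2 + 4 / eps) + 1) * energy_int t \<le> gain * energy_int t"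
    using energy_nonneg
  proof (rule mult_right_mono[rotated])
    have "B * L\<^sup>2 \<ge> 0" using B_nonneg by simp
    moreover have "1 / eps \<ge> 0" "eps * L\<^sup>2 \<ge> 0" using eps_pos by auto
    moreover have "gain = 3 * L + 3 / 4 * (9 / 2 * eps * L\<^sup>2 + 4 / eps) + 1
        + (18 * (B * L\<^sup>2) + 1 / eps + 5 / 8 * (eps * L\<^sup>2))"
      using eps_pos by (simp add: gain_def field_simps)
    ultimately show "3 * L + 3 / 4 * (9 / 2 * eps * L\<^sup>2 + 4 / eps) + 1 \<le> gain" by linarith
  qed
  have K': "(3 * L + 3 / 4 * (9 / 2 * eps * L\<^sup>2 + 4 / eps) + 1) * energy_int t
      = 3 * L * energy_int t + 3 / 4 * ((9 / 2 * eps * L\<^sup>2 + 4 / eps) * energy_int t) + energy_int t"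
    by (simp add: algebra_simps)
  show "energy_int t + 3 / 16 * damped_mass_int t \<le> lyapunov t"
    using M3 M1' K unfolding G K' by linarith
  show "lyapunov t \<le> damped_mass_int t + 2 * gain * energy_int t"
    using M3 M1' K energy_nonneg[of t] damped_mass_nonneg[of t] unfolding G K' by linarith
qed

text \<open>The coefficients are chosen so that the derivative of this functional is nonpositive: the terms
  \<open>energy_int\<close> and \<open>damped_mass_int\<close> produced by differentiating \<open>t * lyapunov t\<close> are absorbed by
  \<open>lyapunov\<close> and \<open>potential_int\<close>.\<close>

definition weighted_lyapunov :: "real \<Rightarrow> real" where
  "weighted_lyapunov t = t * lyapunov t + 10 * gain * lyapunov t + 2 * gain * potential_int t
    + t\<^sup>2 * energy_int t / 10"

lemma gain_ge_1: "gain \<ge> 1"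
  using L_pos eps_pos B_nonneg by (simp add: gain_def add_nonneg_nonneg)

lemma weighted_lyapunov_decreasing:
  assumes "2 \<le> t"
  shows "weighted_lyapunov t \<le> weighted_lyapunov 2"
proof (rule DERIV_nonpos_imp_nonincreasing[OF assms])
  fix s :: real assume "2 \<le> s" "s \<le> t"
  then have s: "s > 1" "s > 0" by auto
  obtain G' where G': "(lyapunov has_real_derivative G') (at s)" "G' \<le> - (1 / 5) * energy_int s"
    using lyapunov_deriv[OF s(2)] by blast
  let ?D = "LINT x|lborel. a x * (ut s x)\<^sup>2"
  have D: "?D \<ge> 0" using a_nonneg by simp
  have "(weighted_lyapunov has_real_derivative lyapunov s + s * G' + 10 * gain * G'
      + 2 * gain * (- damped_mass_int s) + (2 * s * energy_int s + s\<^sup>2 * (- ?D)) / 10) (at s)"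
    unfolding weighted_lyapunov_def[abs_def]
    by (auto intro!: derivative_eq_intros G'(1) energy_deriv[OF s(2)] potential_deriv[OF s(1)])
  moreover have "lyapunov s + s * G' + 10 * gain * G'
      + 2 * gain * (- damped_mass_int s) + (2 * s * energy_int s + s\<^sup>2 * (- ?D)) / 10 \<le> 0"
  proof -
    \<comment> \<open>The accounting: \<open>s * G'\<close> cancels the derivative of the factor in
      \<open>s\<^sup>2 * energy_int s / 10\<close>; \<open>10 * gain * G'\<close> cancels the
      \<open>2 * gain * energy_int s\<close> in the upper bound of \<open>lyapunov\<close>;
      \<open>potential_int\<close> pays for the damped mass.\<close>
    have "s * G' \<le> s * (- (1 / 5) * energy_int s)" using G'(2) s by (intro mult_left_mono) auto
    moreover have "10 * gain * G' \<le> 10 * gain * (- (1 / 5) * energy_int s)"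
      using G'(2) gain_ge_1 by (intro mult_left_mono) auto
    moreover have "damped_mass_int s \<le> gain * damped_mass_int s"
      using gain_ge_1 mult_right_mono[OF _ damped_mass_nonneg[of s], of 1 gain] by simp
    moreover have "s\<^sup>2 * ?D \<ge> 0" using D by simp
    moreover have "damped_mass_int s \<ge> 0" by (rule damped_mass_nonneg)
    ultimately show ?thesis
      using lyapunov_bounds(2)[OF s(2)] by (simp add: field_simps)
  qed
  ultimately show "\<exists>y. (weighted_lyapunov has_real_derivative y) (at s) \<and> y \<le> 0" by blast
qed

lemma weighted_decay:
  obtains C where "\<And>t. t \<ge> max 2 R \<Longrightarrow> t * lyapunov t + t\<^sup>2 * energy_int t / 10 \<le> C * ln t"
proof -
  define F where "F = (LINT x|lborel. (potential_data x)\<^sup>2 * (1 + ((x $ 1)\<^sup>2 + (x $ 2)\<^sup>2))\<^sup>2)"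
  have F: "F \<ge> 0" by (simp add: F_def)
  \<comment> \<open>Dividing by \<open>ln 2\<close> absorbs the constant
    \<open>weighted_lyapunov 2\<close> into \<open>ln t\<close> for \<open>t \<ge> 2\<close>;
    \<open>20 * gain * F\<close> is \<open>2 * gain\<close> times the factor \<open>2 * 5\<close>
    from the potential and logarithm bounds.\<close>
  define C where "C = \<bar>weighted_lyapunov 2\<bar> / ln 2 + 20 * gain * F"
  have "t * lyapunov t + t\<^sup>2 * energy_int t / 10 \<le> C * ln t" if t: "t \<ge> max 2 R" for t
  proof -
    have t1: "t > 1" "t > 0" "t \<ge> 2" "t \<ge> R" using t by auto
    have "ln (1 + (R + t)\<^sup>2) * F \<le> 5 * ln t * F"
      using ln_shifted_square_le[of R t] R_pos t1 F by (intro mult_right_mono) auto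
    moreover have "potential_int t \<ge> - (2 * ln (1 + (R + t)\<^sup>2) * F)"
      unfolding F_def by (rule potential_lower_bound[OF t1(1)])
    ultimately have "potential_int t \<ge> - (10 * ln t * F)" by linarith
    then have "2 * gain * potential_int t \<ge> 2 * gain * - (10 * ln t * F)"
      using gain_ge_1 by (intro mult_left_mono) auto
    then have "2 * gain * potential_int t \<ge> - (20 * (gain * ln t * F))" by (simp add: mult_ac)
    moreover have "10 * gain * lyapunov t \<ge> 0"
      using lyapunov_bounds(1)[OF t1(2)] energy_nonneg[of t] damped_mass_nonneg[of t] gain_ge_1 by simp
    moreover have "weighted_lyapunov 2 \<le> \<bar>weighted_lyapunov 2\<bar> / ln 2 * ln t"
    proof -
      have "\<bar>weighted_lyapunov 2\<bar> / ln 2 * ln 2 \<le> \<bar>weighted_lyapunov 2\<bar> / ln 2 * ln t"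
        using t1 by (intro mult_left_mono) auto
      then show ?thesis by simp
    qed
    ultimately have "t * lyapunov t + t\<^sup>2 * energy_int t / 10
        \<le> \<bar>weighted_lyapunov 2\<bar> / ln 2 * ln t + 20 * (gain * ln t * F)"
      using weighted_lyapunov_decreasing[OF t1(3)] unfolding weighted_lyapunov_def[of t] by linarith
    then show ?thesis by (simp add: C_def algebra_simps)
  qed
  then show ?thesis by (rule that)
qed

theorem decay_rates:
  "mass_int \<in> O[at_top](\<lambda>t. ln t / t)" "energy_int \<in> O[at_top](\<lambda>t. ln t / t\<^sup>2)"
proof -
  obtain C where C: "\<And>t. t \<ge> max 2 R \<Longrightarrow> t * lyapunov t + t\<^sup>2 * energy_int t / 10 \<le> C * ln t"
    using weighted_decay by blast
  \<comment> \<open>The constant in \<open>mass_int t \<le> c * lyapunov t\<close>;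
    \<open>16/3\<close> inverts the \<open>3/16\<close> of \<open>lyapunov_bounds\<close>.\<close>
  define c where "c = 36 * L\<^sup>2 + 2 / eps * (16 / 3)"
  have c: "c \<ge> 0" using eps_pos by (simp add: c_def)
  have ev: "eventually (\<lambda>t. t \<ge> max 2 R) at_top" by (rule eventually_ge_at_top)
  have bounds: "t * lyapunov t \<le> C * ln t \<and> t\<^sup>2 * energy_int t \<le> 10 * C * ln t" if t: "t \<ge> max 2 R" for t
  proof -
    have "lyapunov t \<ge> 0"
      using lyapunov_bounds(1)[of t] energy_nonneg[of t] damped_mass_nonneg[of t] t by auto
    then have "t * lyapunov t \<ge> 0" using t by auto
    moreover have "t\<^sup>2 * energy_int t \<ge> 0" using energy_nonneg by simp
    ultimately show ?thesis using C[OF t] by linarith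
  qed
  show "mass_int \<in> O[at_top](\<lambda>t. ln t / t)"
  proof (rule bigoI[of _ "c * C"], rule eventually_mono[OF ev])
    fix t assume t: "t \<ge> max 2 R"
    then have t0: "t > 0" by auto
    have "36 * L\<^sup>2 * energy_int t \<le> 36 * L\<^sup>2 * lyapunov t"
      using lyapunov_bounds(1)[OF t0] damped_mass_nonneg[of t] by (intro mult_left_mono) auto
    moreover have "2 / eps * damped_mass_int t \<le> 2 / eps * (16 / 3 * lyapunov t)"
      using lyapunov_bounds(1)[OF t0] energy_nonneg[of t] eps_pos by (intro mult_left_mono) auto
    ultimately have "mass_int t \<le> c * lyapunov t"
      using mass_le[OF t0] by (simp add: c_def algebra_simps)
    also have "lyapunov t \<le> C * ln t / t"
      using bounds[OF t] t0 by (simp add: pos_le_divide_eq mult.commute)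
    then have "c * lyapunov t \<le> c * (C * ln t / t)" using c by (rule mult_left_mono)
    finally have "mass_int t \<le> c * C * (ln t / t)" by simp
    moreover have "mass_int t \<ge> 0" by (simp add: mass_int_def)
    moreover have "ln t / t \<ge> 0" using t by auto
    ultimately show "norm (mass_int t) \<le> c * C * norm (ln t / t)"
      by (simp only: real_norm_def abs_of_nonneg)
  qed
  show "energy_int \<in> O[at_top](\<lambda>t. ln t / t\<^sup>2)"
  proof (rule bigoI[of _ "10 * C"], rule eventually_mono[OF ev])
    fix t assume t: "t \<ge> max 2 R"
    then have t0: "t > 0" by auto
    have "energy_int t \<le> 10 * C * (ln t / t\<^sup>2)"
      using bounds[OF t] t0 by (simp add: pos_le_divide_eq mult.commute)
    moreover have "ln t / t\<^sup>2 \<ge> 0" using t by auto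
    ultimately show "norm (energy_int t) \<le> 10 * C * norm (ln t / t\<^sup>2)"
      using energy_nonneg[of t] by (simp only: real_norm_def abs_of_nonneg)
  qed
qed

end

theorem theorem1p1:
  fixes R :: real
    and u0 u1 a :: "real^2 \<Rightarrow> real"
    and u :: "real \<Rightarrow> real^2 \<Rightarrow> real"
  assumes "R > 0"
    and "test_function u0" and "supp u0 \<subseteq> cball 0 R"
    and "test_function u1" and "supp u1 \<subseteq> cball 0 R"
    and "Ck_on 2 a UNIV" and "\<forall>x. a x \<ge> 0" and "bounded (range a)"
    and "\<exists>L>0. \<exists>\<epsilon>\<^sub>0>0. \<forall>x. norm x > L \<longrightarrow> a x \<ge> \<epsilon>\<^sub>0"
    and "classical_solution a u0 u1 u"
  shows "(\<forall>t>0. integrable lborel (\<lambda>x. \<bar>u t x\<bar>\<^sup>2) \<and> integrable lborel (energy_density u t))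
    \<and> (\<lambda>t. LINT x|lborel. \<bar>u t x\<bar>\<^sup>2) \<in> O[at_top](\<lambda>t. ln t / t)
    \<and> energy u \<in> O[at_top](\<lambda>t. ln t / t\<^sup>2)"
proof -
  obtain ut utt ux uy utx uty uxx uxy uyy where
    dw: "damped_wave a R u ut utt ux uy utx uty uxx uxy uyy"
    and dt: "\<And>t x. t > 0 \<Longrightarrow> dt u t x = ut t x"
    and grad: "\<And>t x. t > 0 \<Longrightarrow> (norm (grad (u t) x))\<^sup>2 = (ux t x)\<^sup>2 + (uy t x)\<^sup>2"
    by (rule classical_solution_damped_wave[OF assms(10,1,3,5,6,7)]) (rule that)
  obtain L eps where Le: "L > 0" "eps > 0" "\<And>x. norm x > L \<Longrightarrow> a x \<ge> eps"
    using assms(9) by blast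
  obtain B where B: "\<And>x. \<bar>a x\<bar> \<le> B"
    using assms(8) by (auto simp: bounded_iff)
  interpret effectively_damped_wave a R u ut utt ux uy utx uty uxx uxy uyy L eps B
  proof (intro effectively_damped_wave.intro dw effectively_damped_wave_axioms.intro)
    show "a x \<le> B" for x using B[of x] by linarith
  qed (use Le in auto)
  have density: "energy_density u t = (\<lambda>x. 2 * energy_dens t x)" if "t > 0" for t
    using that by (auto simp: energy_density_def energy_dens_def dt grad)
  have energy: "energy u t = energy_int t" if "t > 0" for t
    unfolding energy_def density[OF that] energy_int_def Bochner_Integration.integral_mult_right_zero by simp
  \<comment> \<open>The identification with \<open>energy_int\<close> holds for
    \<open>t > 0\<close>, where \<open>dt\<close> is the actual time derivative; the rate concerns
    only large \<open>t\<close>.\<close>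
  have "eventually (\<lambda>t. energy u t = energy_int t) at_top"
    using eventually_gt_at_top[of 0] by eventually_elim (rule energy)
  then have "energy u \<in> O[at_top](\<lambda>t. ln t / t\<^sup>2)"
    using decay_rates(2) by (subst landau_o.big.in_cong)
  moreover have "integrable lborel (\<lambda>x. \<bar>u t x\<bar>\<^sup>2)" "integrable lborel (energy_density u t)" if "t > 0" for t
    using integrable_terms(1,2)[OF that] by (simp_all only: density[OF that] power2_abs integrable_mult_right)
  moreover have "(\<lambda>t. LINT x|lborel. \<bar>u t x\<bar>\<^sup>2) \<in> O[at_top](\<lambda>t. ln t / t)"
    using decay_rates(1) by (simp add: mass_int_def[abs_def])
  ultimately show ?thesis by blast
qed

end
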